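(* Under the standing assumptions and notation below, if the minimal operator $L_0$ is formally normal in $L^2$, then $D(L_0)\subset \mathring{W}_2^2$ and $A\,D(L_0)\subset L^2$.
   Context: Let $(a_n),(b_n)$ be real sequences with $-\infty<a_n<b_n\le a_{n+1}<\infty$, $\Delta_n=(a_n,b_n)$. For each $n\ge1$, $H_n$ is a Hilbert space and $A_n$ a positive definite selfadjoint operator in $H_n$. $L_n^2=L^2(H_n,\Delta_n)$, $L^2=\bigoplus_n L^2_n$ (Hilbert direct sum). $l_n(u_n)=-u_n''+iA_nu_n$. $L_{n0}$ is the closure in $L^2_n$ of $u_n\mapsto l_n(u_n)$ defined on finite sums $\sum_k\varphi_kf_k$, $\varphi_k\in C_0^\infty(\Delta_n)$, $f_k\in D(A_n)$, and $L_0=\bigoplus_nL_{n0}$ (domain: $u=(u_n)\in L^2$, $u_n\in D(L_{n0})$, $\sum_n\|L_{n0}u_n\|^2<\infty$). An operator $T$ is formally normal if it is densely defined, $D(T)\subset D(T^* )$ and $\|Tu\|=\|T^*u\|$ for all $u\in D(T)$. $\mathring W_2^2=\bigoplus_n \mathring W_2^2(H_n,\Delta_n)$, where $\mathring W_2^2(H_n,\Delta_n)$ is the $H_n$-valued Sobolev space of order 2 on $\Delta_n$ of functions with $u_n(a_n)=u_n(b_n)=u_n'(a_n)=u_n'(b_n)=0$, and the direct sum consists of sequences with $\sum_n\|u_n\|^2_{W_2^2}<\infty$. $A$ denotes the operator acting by $(Au)_n(t)=A_nu_n(t)$. *)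

theory Defs
  imports "HOL-Analysis.Analysis"
begin

text \<open>A complex Hilbert space is modelled as a real Hilbert space (type class
  real_inner + complete_space) together with a complex structure J (multiplication
  by the imaginary unit): J is real-linear, orthogonal, and J (J x) = - x.
  The spaces H_n are J-invariant closed subspaces of one ambient such space.\<close>

definition complex_structure :: "('h::real_inner \<Rightarrow> 'h) \<Rightarrow> bool" where
  "complex_structure J \<longleftrightarrow> linear J \<and> (\<forall>x. J (J x) = - x) \<and> (\<forall>x y. inner (J x) (J y) = inner x y)"

definition complex_hilbert_subspace :: "('h::real_inner \<Rightarrow> 'h) \<Rightarrow> 'h set \<Rightarrow> bool" where
  "complex_hilbert_subspace J S \<longleftrightarrow> subspace S \<and> closed S \<and> J ` S \<subseteq> S"

text \<open>A (possibly unbounded) operator in the Hilbert space Hs with domain D, acting by A.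
  Positive definite selfadjoint (complex-linear, i.e. commuting with J).
  For J-commuting operators the complex adjoint coincides with the real adjoint,
  so selfadjointness is expressed with the real inner product.
  Positive definite: inner (A x) x \<ge> c * norm x ^ 2 for some c > 0.\<close>

definition pos_def_selfadjoint ::
  "('h::real_inner \<Rightarrow> 'h) \<Rightarrow> 'h set \<Rightarrow> 'h set \<Rightarrow> ('h \<Rightarrow> 'h) \<Rightarrow> bool" where
  "pos_def_selfadjoint J Hs D A \<longleftrightarrow>
     subspace D \<and> D \<subseteq> Hs \<and> Hs \<subseteq> closure D \<and> J ` D \<subseteq> D \<and>
     (\<forall>x\<in>D. A x \<in> Hs) \<and>
     (\<forall>x\<in>D. \<forall>y\<in>D. A (x + y) = A x + A y) \<and>
     (\<forall>x\<in>D. \<forall>c. A (c *\<^sub>R x) = c *\<^sub>R A x) \<and>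
     (\<forall>x\<in>D. A (J x) = J (A x)) \<and>
     (\<forall>x\<in>D. \<forall>y\<in>D. inner (A x) y = inner x (A y)) \<and>
     (\<forall>y\<in>Hs. (\<exists>z\<in>Hs. \<forall>x\<in>D. inner (A x) y = inner x z) \<longrightarrow> y \<in> D) \<and>
     (\<exists>c>0. \<forall>x\<in>D. inner (A x) x \<ge> c * (norm x)\<^sup>2)"

definition strongly_measurable_on :: "real set \<Rightarrow> (real \<Rightarrow> 'h::real_normed_vector) \<Rightarrow> bool" where
  "strongly_measurable_on S u \<longleftrightarrow>
     (\<exists>s::nat \<Rightarrow> real \<Rightarrow> 'h. (\<forall>k. s k \<in> borel_measurable lebesgue \<and> finite (range (s k))) \<and>
        (AE t in lebesgue. t \<in> S \<longrightarrow> (\<lambda>k. s k t) \<longlonglongrightarrow> u t))"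

definition L2sq :: "real set \<Rightarrow> (real \<Rightarrow> 'h::real_normed_vector) \<Rightarrow> ennreal" where
  "L2sq S u = (\<integral>\<^sup>+ t. indicator S t * ennreal ((norm (u t))\<^sup>2) \<partial>lebesgue)"

definition L2on :: "real set \<Rightarrow> 'h set \<Rightarrow> (real \<Rightarrow> 'h::real_normed_vector) \<Rightarrow> bool" where
  "L2on S Hs u \<longleftrightarrow> strongly_measurable_on S u \<and> (AE t in lebesgue. t \<in> S \<longrightarrow> u t \<in> Hs) \<and>
     L2sq S u < \<infinity>"

definition L2inner :: "real set \<Rightarrow> (real \<Rightarrow> 'h::real_inner) \<Rightarrow> (real \<Rightarrow> 'h) \<Rightarrow> real" where
  "L2inner S u v = (LINT t:S|lebesgue. inner (u t) (v t))"

definition Delta :: "(nat \<Rightarrow> real) \<Rightarrow> (nat \<Rightarrow> real) \<Rightarrow> nat \<Rightarrow> real set" where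
  "Delta a b n = {a n<..<b n}"

definition L2sum :: "(nat \<Rightarrow> real) \<Rightarrow> (nat \<Rightarrow> real) \<Rightarrow> (nat \<Rightarrow> 'h set) \<Rightarrow>
    (nat \<Rightarrow> real \<Rightarrow> 'h::real_normed_vector) \<Rightarrow> bool" where
  "L2sum a b H U \<longleftrightarrow> (\<forall>n. L2on (Delta a b n) (H n) (U n)) \<and> (\<Sum>n. L2sq (Delta a b n) (U n)) < \<infinity>"

definition L2norm :: "(nat \<Rightarrow> real) \<Rightarrow> (nat \<Rightarrow> real) \<Rightarrow> (nat \<Rightarrow> real \<Rightarrow> 'h::real_normed_vector) \<Rightarrow> real" where
  "L2norm a b U = sqrt (enn2real (\<Sum>n. L2sq (Delta a b n) (U n)))"

definition L2ip :: "(nat \<Rightarrow> real) \<Rightarrow> (nat \<Rightarrow> real) \<Rightarrow> (nat \<Rightarrow> real \<Rightarrow> 'h::real_inner) \<Rightarrow>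
    (nat \<Rightarrow> real \<Rightarrow> 'h) \<Rightarrow> real" where
  "L2ip a b U V = (\<Sum>n. L2inner (Delta a b n) (U n) (V n))"

type_synonym 'h L2elt = "nat \<Rightarrow> real \<Rightarrow> 'h"

definition adjoint_graph :: "(nat \<Rightarrow> real) \<Rightarrow> (nat \<Rightarrow> real) \<Rightarrow> (nat \<Rightarrow> 'h set) \<Rightarrow>
    ('h::real_inner L2elt \<times> 'h L2elt) set \<Rightarrow> ('h L2elt \<times> 'h L2elt) set" where
  "adjoint_graph a b H G = {(Y, Z). L2sum a b H Y \<and> L2sum a b H Z \<and>
      (\<forall>(X, W)\<in>G. L2ip a b W Y = L2ip a b X Z)}"

definition formally_normal :: "(nat \<Rightarrow> real) \<Rightarrow> (nat \<Rightarrow> real) \<Rightarrow> (nat \<Rightarrow> 'h set) \<Rightarrow>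
    ('h::real_inner L2elt \<times> 'h L2elt) set \<Rightarrow> bool" where
  "formally_normal a b H G \<longleftrightarrow>
     (\<forall>(X, W)\<in>G. L2sum a b H X \<and> L2sum a b H W) \<and>
     (\<forall>U. L2sum a b H U \<longrightarrow> (\<forall>e>0. \<exists>(X, W)\<in>G. L2norm a b (\<lambda>n t. U n t - X n t) < e)) \<and>
     (\<forall>(X, W)\<in>G. (\<exists>Z. (X, Z) \<in> adjoint_graph a b H G) \<and>
        (\<forall>Z. (X, Z) \<in> adjoint_graph a b H G \<longrightarrow> L2norm a b W = L2norm a b Z))"

definition smooth_fun :: "(real \<Rightarrow> real) \<Rightarrow> bool" where
  "smooth_fun \<phi> \<longleftrightarrow> (\<exists>d::nat \<Rightarrow> real \<Rightarrow> real. d 0 = \<phi> \<and>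
      (\<forall>k t. (d k has_real_derivative d (Suc k) t) (at t)))"

text \<open>C_0^infinity((a,b)), real-valued (complex-valued test functions give the same
  span since D(A_n) is J-invariant).\<close>

definition test_fun :: "real \<Rightarrow> real \<Rightarrow> (real \<Rightarrow> real) \<Rightarrow> bool" where
  "test_fun a b \<phi> \<longleftrightarrow> smooth_fun \<phi> \<and>
     (\<exists>c d. a < c \<and> d < b \<and> (\<forall>t. t \<notin> {c..d} \<longrightarrow> \<phi> t = 0))"

definition lpre_graph :: "real \<Rightarrow> real \<Rightarrow> ('h::real_normed_vector \<Rightarrow> 'h) \<Rightarrow> 'h set \<Rightarrow> ('h \<Rightarrow> 'h) \<Rightarrow>
    ((real \<Rightarrow> 'h) \<times> (real \<Rightarrow> 'h)) set" where
  "lpre_graph a b J Dn An =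
     {((\<lambda>t. sum_list (map (\<lambda>(\<phi>, f). \<phi> t *\<^sub>R f) ps)),
       (\<lambda>t. sum_list (map (\<lambda>(\<phi>, f). (- deriv (deriv \<phi>) t) *\<^sub>R f + \<phi> t *\<^sub>R J (An f)) ps))) | ps.
        \<forall>(\<phi>, f)\<in>set ps. test_fun a b \<phi> \<and> f \<in> Dn}"

definition L2_graph_closure :: "real set \<Rightarrow> 'h set \<Rightarrow> ((real \<Rightarrow> 'h::real_normed_vector) \<times> (real \<Rightarrow> 'h)) set \<Rightarrow>
    ((real \<Rightarrow> 'h) \<times> (real \<Rightarrow> 'h)) set" where
  "L2_graph_closure S Hs G = {(u, v). L2on S Hs u \<and> L2on S Hs v \<and>
     (\<exists>s::nat \<Rightarrow> (real \<Rightarrow> 'h) \<times> (real \<Rightarrow> 'h). (\<forall>k. s k \<in> G) \<and>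
        (\<lambda>k. L2sq S (\<lambda>t. fst (s k) t - u t)) \<longlonglongrightarrow> 0 \<and>
        (\<lambda>k. L2sq S (\<lambda>t. snd (s k) t - v t)) \<longlonglongrightarrow> 0)}"

definition L0_graph :: "(nat \<Rightarrow> real) \<Rightarrow> (nat \<Rightarrow> real) \<Rightarrow> (nat \<Rightarrow> 'h set) \<Rightarrow> ('h \<Rightarrow> 'h) \<Rightarrow>
    (nat \<Rightarrow> 'h set) \<Rightarrow> (nat \<Rightarrow> 'h \<Rightarrow> 'h) \<Rightarrow> ('h::real_normed_vector L2elt \<times> 'h L2elt) set" where
  "L0_graph a b H J D A = {(U, V). L2sum a b H U \<and> L2sum a b H V \<and>
     (\<forall>n. (U n, V n) \<in> L2_graph_closure (Delta a b n) (H n) (lpre_graph (a n) (b n) J (D n) (A n)))}"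

text \<open>u (on (a,b)) lies in W_2^2 with u(a)=u(b)=u'(a)=u'(b)=0, witnessed by a
  representative U, equal to u a.e., which is C^1 on [a,b] with derivative U',
  U' absolutely continuous with second derivative W in L^2 (expressed weakly:
  inner (U' t) h = inner (U' a) h + integral_a^t inner (W s) h).\<close>

definition W22_0_piece :: "real \<Rightarrow> real \<Rightarrow> 'h set \<Rightarrow> (real \<Rightarrow> 'h::real_inner) \<Rightarrow>
    (real \<Rightarrow> 'h) \<Rightarrow> (real \<Rightarrow> 'h) \<Rightarrow> (real \<Rightarrow> 'h) \<Rightarrow> bool" where
  "W22_0_piece a b Hs u U U' W \<longleftrightarrow>
     L2on {a<..<b} Hs W \<and>
     (AE t in lebesgue. t \<in> {a<..<b} \<longrightarrow> U t = u t) \<and>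
     (\<forall>t\<in>{a..b}. (U has_vector_derivative U' t) (at t within {a..b})) \<and>
     (\<forall>h. \<forall>t\<in>{a..b}. inner (U' t) h = inner (U' a) h + (LINT s:{a..t}|lebesgue. inner (W s) h)) \<and>
     U a = 0 \<and> U b = 0 \<and> U' a = 0 \<and> U' b = 0"

definition W22_0_sum :: "(nat \<Rightarrow> real) \<Rightarrow> (nat \<Rightarrow> real) \<Rightarrow> (nat \<Rightarrow> 'h set) \<Rightarrow>
    ('h::real_inner) L2elt \<Rightarrow> bool" where
  "W22_0_sum a b H U \<longleftrightarrow> (\<exists>Ur Ud Wd.
     (\<forall>n. W22_0_piece (a n) (b n) (H n) (U n) (Ur n) (Ud n) (Wd n)) \<and>
     (\<Sum>n. L2sq (Delta a b n) (U n) + L2sq (Delta a b n) (Ud n) + L2sq (Delta a b n) (Wd n)) < \<infinity>)"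

definition A_image_in_L2 :: "(nat \<Rightarrow> real) \<Rightarrow> (nat \<Rightarrow> real) \<Rightarrow> (nat \<Rightarrow> 'h set) \<Rightarrow>
    (nat \<Rightarrow> 'h set) \<Rightarrow> (nat \<Rightarrow> 'h \<Rightarrow> 'h) \<Rightarrow> ('h::real_normed_vector) L2elt \<Rightarrow> bool" where
  "A_image_in_L2 a b H D A U \<longleftrightarrow>
     (\<forall>n. AE t in lebesgue. t \<in> Delta a b n \<longrightarrow> U n t \<in> D n) \<and>
     L2sum a b H (\<lambda>n t. A n (U n t))"

end

theory Submission
  imports Defs
begin

text \<open>On test functions \<open>p\<close> with values in \<open>D(A\<^sub>n)\<close> one has
  \<open>\<parallel>- p'' + i A\<^sub>n p\<parallel>\<^sup>2 = \<parallel>p''\<parallel>\<^sup>2 + \<parallel>A\<^sub>n p\<parallel>\<^sup>2\<close>: the cross term integrates to zero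
  because \<open>Re \<langle>x, i A\<^sub>n x\<rangle> = 0\<close>. Hence convergence in the graph norm forces \<open>L\<^sup>2\<close>-convergence of both
  \<open>p''\<close> and \<open>A\<^sub>n p\<close>. One-dimensional Sobolev inequalities turn this into uniform convergence of
  \<open>p\<close> and \<open>p'\<close>, so the boundary conditions survive in the limit, and \<open>A\<^sub>n\<close> is closed. All bounds have
  constants independent of \<open>n\<close>, so they can be summed.\<close>

section \<open>Strongly measurable functions and the square norm\<close>

text \<open>Values may lie in a nonseparable space, where Borel measurability of a vector-valued
  function says too little. Measurability is therefore carried throughout by sequences of
  finite-valued functions, and every limit function has to be supplied with such a sequence.
  Elements of L^2 are functions rather than classes, so completeness is used in the Riesz-Fischer
  form: some subsequence converges almost everywhere. Squared norms with values in [0,\<infinity>]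
  take the place of norms. Fatou's lemma then yields every bound on a limit, and each use of the
  triangle inequality costs a factor 2. The lengths of the intervals need be neither bounded nor
  bounded away from 0, which rules out Poincare-type estimates. The Sobolev bounds instead integrate
  the derivatives of |e|^2 and of <e,e'>, use zero boundary values, and finish with 2xy \<le> x^2 +
  y^2; the norm of the function itself stays on the right-hand side, and no length appears.\<close>

lemma lebesgue_AE_LIMSEQ_measurable:
  fixes f :: "nat \<Rightarrow> real \<Rightarrow> real"
  assumes "\<And>k. f k \<in> borel_measurable lebesgue" and "AE t in lebesgue. (\<lambda>k. f k t) \<longlonglongrightarrow> g t"
  shows "g \<in> borel_measurable lebesgue"
proof -
  \<comment> \<open>\<open>lim\<close> is total and measurable; completeness of Lebesgue measure
    absorbs the null set on which it may differ from \<open>g\<close>.\<close>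
  define h where "h t = lim (\<lambda>k. f k t)" for t
  have "h \<in> borel_measurable lebesgue"
    unfolding h_def using assms(1) by (rule borel_measurable_lim_metric)
  moreover have "AE t in lebesgue. h t = g t"
    using assms(2) by eventually_elim (simp add: h_def limI)
  ultimately show ?thesis
    by (rule borel_measurable_AE)
qed

text \<open>\<open>h\<close> can be arbitrary because the pair (\<open>s\<close>, \<open>r\<close>)
  is constant on each of finitely many measurable pieces.\<close>

lemma finite_range_measurable_compose2:
  fixes s :: "real \<Rightarrow> 'a::t2_space" and r :: "real \<Rightarrow> 'b::t2_space"
  assumes "s \<in> borel_measurable lebesgue" "finite (range s)"
    and "r \<in> borel_measurable lebesgue" "finite (range r)"
  shows "(\<lambda>t. (h (s t) (r t) :: real)) \<in> borel_measurable lebesgue"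
proof (rule borel_measurable_simple_function)
  have "simple_function lebesgue s" "simple_function lebesgue r"
    using assms by (simp_all add: simple_function_borel_measurable)
  then show "simple_function lebesgue (\<lambda>t. h (s t) (r t))"
    by (rule simple_function_compose2)
qed

lemma strongly_measurable_on_cong_AE:
  assumes "strongly_measurable_on S u" "AE t in lebesgue. t \<in> S \<longrightarrow> u t = v t"
  shows "strongly_measurable_on S v"
proof -
  obtain s where s: "\<And>k. s k \<in> borel_measurable lebesgue \<and> finite (range (s k))"
    and "AE t in lebesgue. t \<in> S \<longrightarrow> (\<lambda>k. s k t) \<longlonglongrightarrow> u t"
    using assms(1) unfolding strongly_measurable_on_def by blast
  from this(2) assms(2) have "AE t in lebesgue. t \<in> S \<longrightarrow> (\<lambda>k. s k t) \<longlonglongrightarrow> v t"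
    by eventually_elim auto
  with s show ?thesis unfolding strongly_measurable_on_def by (intro exI[of _ s]) simp
qed

lemma strongly_measurable_on_subset:
  assumes "strongly_measurable_on T u" "S \<subseteq> T"
  shows "strongly_measurable_on S u"
proof -
  obtain s where s: "\<And>k. s k \<in> borel_measurable lebesgue \<and> finite (range (s k))"
    and lim: "AE t in lebesgue. t \<in> T \<longrightarrow> (\<lambda>k. s k t) \<longlonglongrightarrow> u t"
    using assms(1) unfolding strongly_measurable_on_def by blast
  have "AE t in lebesgue. t \<in> S \<longrightarrow> (\<lambda>k. s k t) \<longlonglongrightarrow> u t"
    by (rule eventually_mono[OF lim]) (use assms(2) in auto)
  with s show ?thesis unfolding strongly_measurable_on_def by (intro exI[of _ s]) simp
qed

lemma strongly_measurable_on_diff: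
  assumes "strongly_measurable_on S u" "strongly_measurable_on S v"
  shows "strongly_measurable_on S (\<lambda>t. u t - v t)"
proof -
  obtain s where s: "\<And>k. s k \<in> borel_measurable lebesgue \<and> finite (range (s k))"
    "AE t in lebesgue. t \<in> S \<longrightarrow> (\<lambda>k. s k t) \<longlonglongrightarrow> u t"
    using assms(1) unfolding strongly_measurable_on_def by blast
  obtain r where r: "\<And>k. r k \<in> borel_measurable lebesgue \<and> finite (range (r k))"
    "AE t in lebesgue. t \<in> S \<longrightarrow> (\<lambda>k. r k t) \<longlonglongrightarrow> v t"
    using assms(2) unfolding strongly_measurable_on_def by blast
  have "simple_function lebesgue (s k)" "simple_function lebesgue (r k)" for k
    using s(1)[of k] r(1)[of k] by (simp_all add: simple_function_borel_measurable)
  then have sf: "simple_function lebesgue (\<lambda>t. s k t - r k t)" for k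
    by (rule simple_function_diff)
  have "(\<lambda>t. s k t - r k t) \<in> borel_measurable lebesgue \<and> finite (range (\<lambda>t. s k t - r k t))" for k
    using borel_measurable_simple_function[OF sf, of k] simple_functionD(1)[OF sf, of k] by simp
  moreover have "AE t in lebesgue. t \<in> S \<longrightarrow> (\<lambda>k. s k t - r k t) \<longlonglongrightarrow> u t - v t"
    using s(2) r(2) by eventually_elim (auto intro: tendsto_diff)
  ultimately show ?thesis
    unfolding strongly_measurable_on_def by (intro exI[of _ "\<lambda>k t. s k t - r k t"]) simp
qed

text \<open>Continuity of \<open>h\<close> serves only to pass from the finite-valued approximants
  to the limit. This avoids the Borel sets of the product space, which can exceed the product
  sigma-algebra when the space is nonseparable. Norms, norms of differences and inner products are
  all instances.\<close>

lemma strongly_measurable_on_measurable2: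
  fixes u v :: "real \<Rightarrow> 'h::real_normed_vector" and h :: "'h \<Rightarrow> 'h \<Rightarrow> real"
  assumes "strongly_measurable_on S u" "strongly_measurable_on S v" "S \<in> sets lebesgue"
    and cont: "continuous_on UNIV (\<lambda>(x, y). h x y)"
  shows "(\<lambda>t. indicator S t * h (u t) (v t)) \<in> borel_measurable lebesgue"
proof -
  obtain s where s: "\<And>k. s k \<in> borel_measurable lebesgue \<and> finite (range (s k))"
    "AE t in lebesgue. t \<in> S \<longrightarrow> (\<lambda>k. s k t) \<longlonglongrightarrow> u t"
    using assms(1) unfolding strongly_measurable_on_def by blast
  obtain r where r: "\<And>k. r k \<in> borel_measurable lebesgue \<and> finite (range (r k))"
    "AE t in lebesgue. t \<in> S \<longrightarrow> (\<lambda>k. r k t) \<longlonglongrightarrow> v t"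
    using assms(2) unfolding strongly_measurable_on_def by blast
  show ?thesis
  proof (rule lebesgue_AE_LIMSEQ_measurable)
    show "(\<lambda>t. indicator S t * h (s k t) (r k t)) \<in> borel_measurable lebesgue" for k
      using s(1)[of k] r(1)[of k] assms(3)
      using finite_range_measurable_compose2[of "s k" "r k" h]
      by (intro borel_measurable_times borel_measurable_indicator) auto
    show "AE t in lebesgue. (\<lambda>k. indicator S t * h (s k t) (r k t)) \<longlonglongrightarrow> indicator S t * h (u t) (v t)"
      using s(2) r(2)
    proof eventually_elim
      case (elim t)
      show ?case
      proof (cases "t \<in> S")
        case True
        then have "(\<lambda>k. (s k t, r k t)) \<longlonglongrightarrow> (u t, v t)"
          using elim by (auto intro: tendsto_Pair)
        from continuous_on_tendsto_compose[OF cont this] show ?thesis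
          by (auto intro: tendsto_mult)
      qed auto
    qed
  qed
qed

text \<open>Induction over a finite net: each new centre \<open>c\<close> overrides the earlier
  choice on its own ball, which is a measurable set of times because \<open>dist (f t) c\<close> is
  a measurable real function.\<close>

lemma totally_bounded_finite_range_approx:
  fixes f :: "real \<Rightarrow> 'h::real_normed_vector"
  assumes f: "f \<in> borel_measurable lebesgue" and C: "finite C"
  shows "\<exists>s. s \<in> borel_measurable lebesgue \<and> finite (range s) \<and>
    (\<forall>t. (\<exists>c\<in>C. dist (f t) c < e) \<longrightarrow> dist (f t) (s t) < e)"
  using C
proof induction
  case empty
  show ?case by (intro exI[of _ "\<lambda>_. 0"]) auto
next
  case (insert c C)
  then obtain s where s: "s \<in> borel_measurable lebesgue" "finite (range s)"
    "\<And>t. (\<exists>c\<in>C. dist (f t) c < e) \<Longrightarrow> dist (f t) (s t) < e"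
    by blast
  have "range (\<lambda>t. if dist (f t) c < e then c else s t) \<subseteq> insert c (range s)" by auto
  then have "finite (range (\<lambda>t. if dist (f t) c < e then c else s t))"
    using s(2) finite_subset by blast
  moreover have "(\<lambda>t. if dist (f t) c < e then c else s t) \<in> borel_measurable lebesgue"
  proof (rule measurable_If)
    have "(\<lambda>t. dist (f t) c) \<in> borel_measurable lebesgue"
      by (rule measurable_compose[OF f]) (auto intro!: borel_measurable_continuous_onI continuous_intros)
    then show "{t \<in> space lebesgue. dist (f t) c < e} \<in> sets lebesgue" by measurable
  qed (use s(1) in auto)
  ultimately show ?case
    using s(3) by (intro exI[of _ "\<lambda>t. if dist (f t) c < e then c else s t"]) auto
qed

lemma continuous_finite_range_approx:
  fixes f :: "real \<Rightarrow> 'h::real_normed_vector"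
  assumes f: "continuous_on UNIV f" and 0: "\<And>t. t \<notin> {a..b} \<Longrightarrow> f t = 0" and e: "e > 0"
  shows "\<exists>s. s \<in> borel_measurable lebesgue \<and> finite (range s) \<and> (\<forall>t. dist (f t) (s t) < e)"
proof -
  have "compact (f ` {a..b})"
    by (rule compact_continuous_image) (auto intro: continuous_on_subset[OF f])
  then obtain C where C: "finite C" "f ` {a..b} \<subseteq> (\<Union>c\<in>C. ball c e)"
    using e unfolding compact_eq_totally_bounded by meson
  have meas: "f \<in> borel_measurable lebesgue"
    using f by (intro measurable_completion) (simp add: borel_measurable_continuous_onI)
  have "\<exists>c\<in>insert 0 C. dist (f t) c < e" for t
    using C(2) 0[of t] e by (cases "t \<in> {a..b}") (force simp: dist_commute)+
  with totally_bounded_finite_range_approx[OF meas, of "insert 0 C" e] C(1) show ?thesis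
    by (metis finite_insert)
qed

text \<open>The image of each \<open>f k\<close> is contained in a compact set together with 0, so
  \<open>f k\<close> has a finite-valued approximant within 1/(k+1) at every point. The approximants
  then converge wherever the \<open>f k\<close> do, with the same limit.\<close>

lemma strongly_measurable_on_AE_LIMSEQ:
  fixes f :: "nat \<Rightarrow> real \<Rightarrow> 'h::real_normed_vector"
  assumes f: "\<And>k. continuous_on UNIV (f k)" and 0: "\<And>k t. t \<notin> {a..b} \<Longrightarrow> f k t = 0"
    and lim: "AE t in lebesgue. t \<in> S \<longrightarrow> (\<lambda>k. f k t) \<longlonglongrightarrow> g t"
  shows "strongly_measurable_on S g"
proof -
  have "\<exists>s. s \<in> borel_measurable lebesgue \<and> finite (range s) \<and>
      (\<forall>t. dist (f k t) (s t) < inverse (real (Suc k)))" for k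
    by (rule continuous_finite_range_approx[OF f 0]) auto
  then obtain s where s: "\<And>k. s k \<in> borel_measurable lebesgue \<and> finite (range (s k))"
      "\<And>k t. dist (f k t) (s k t) < inverse (real (Suc k))"
    by metis
  have key: "(\<lambda>k. s k t) \<longlonglongrightarrow> g t" if "(\<lambda>k. f k t) \<longlonglongrightarrow> g t" for t
  proof -
    have "(\<lambda>k. dist (f k t) (s k t)) \<longlonglongrightarrow> 0"
      by (rule tendsto_sandwich[OF _ _ tendsto_const LIMSEQ_inverse_real_of_nat])
        (auto intro!: always_eventually less_imp_le simp del: of_nat_Suc simp: s(2))
    then have "(\<lambda>k. s k t - f k t) \<longlonglongrightarrow> 0"
      by - (rule tendsto_norm_zero_cancel, simp add: dist_norm norm_minus_commute)
    from Lim_transform[OF that this] show ?thesis .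
  qed
  have "AE t in lebesgue. t \<in> S \<longrightarrow> (\<lambda>k. s k t) \<longlonglongrightarrow> g t"
    by (rule eventually_mono[OF lim]) (simp add: key)
  with s(1) show ?thesis unfolding strongly_measurable_on_def by (intro exI[of _ s]) simp
qed

lemma strongly_measurable_on_continuous:
  fixes f :: "real \<Rightarrow> 'h::real_normed_vector"
  assumes "continuous_on UNIV f" "\<And>t. t \<notin> {a..b} \<Longrightarrow> f t = 0"
  shows "strongly_measurable_on S f"
  using strongly_measurable_on_AE_LIMSEQ[of "\<lambda>_. f" a b S f] assms by auto

section \<open>The square norm: doubled triangle inequality and lower semicontinuity\<close>

lemma L2sq_diff_measurable:
  assumes "strongly_measurable_on S u" "strongly_measurable_on S v" "S \<in> sets lebesgue"
  shows "(\<lambda>t. indicator S t * ennreal ((norm (u t - v t))\<^sup>2)) \<in> borel_measurable lebesgue"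
proof -
  have "(\<lambda>t. ennreal (indicator S t * (norm (u t - v t))\<^sup>2)) \<in> borel_measurable lebesgue"
    by (rule measurable_compose[OF strongly_measurable_on_measurable2[OF assms] measurable_ennreal])
      (auto simp: split_beta intro!: continuous_intros)
  moreover have "ennreal (indicator S t * (norm (u t - v t))\<^sup>2) =
      indicator S t * ennreal ((norm (u t - v t))\<^sup>2)" for t
    by (cases "t \<in> S") auto
  ultimately show ?thesis by (simp only:)
qed

lemma strongly_measurable_on_zero: "strongly_measurable_on S (\<lambda>_. 0)"
  unfolding strongly_measurable_on_def by (intro exI[of _ "\<lambda>_ _. 0"]) auto

lemma L2sq_measurable:
  assumes "strongly_measurable_on S u" "S \<in> sets lebesgue"
  shows "(\<lambda>t. indicator S t * ennreal ((norm (u t))\<^sup>2)) \<in> borel_measurable lebesgue"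
  using L2sq_diff_measurable[OF assms(1) strongly_measurable_on_zero assms(2)] by simp

text \<open>The inequality (x + y)^2 \<le> 2 x^2 + 2 y^2 applied to the triangle inequality; the
  factors 2 in the later comparisons with \<open>u\<close> and \<open>v\<close> originate
  here.\<close>

lemma norm_diff_square_le:
  fixes x y z :: "'a::real_normed_vector"
  shows "(norm (x - y))\<^sup>2 \<le> 2 * (norm (x - z))\<^sup>2 + 2 * (norm (z - y))\<^sup>2"
proof -
  have "(norm (x - y))\<^sup>2 \<le> (norm (x - z) + norm (z - y))\<^sup>2"
    by (intro power_mono) (auto simp: norm_triangle_sub intro: order_trans[OF _ norm_triangle_ineq])
  also have "\<dots> \<le> 2 * (norm (x - z))\<^sup>2 + 2 * (norm (z - y))\<^sup>2"
    using sum_squares_bound[of "norm (x - z)" "norm (z - y)"] by (simp add: power2_sum)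
  finally show ?thesis .
qed

lemma L2sq_triangle:
  assumes "strongly_measurable_on S u" "strongly_measurable_on S v" "strongly_measurable_on S w"
    and S: "S \<in> sets lebesgue"
  shows "L2sq S (\<lambda>t. u t - v t) \<le> 2 * L2sq S (\<lambda>t. u t - w t) + 2 * L2sq S (\<lambda>t. w t - v t)"
proof -
  have "L2sq S (\<lambda>t. u t - v t) \<le> (\<integral>\<^sup>+t. 2 * (indicator S t * ennreal ((norm (u t - w t))\<^sup>2)) +
      2 * (indicator S t * ennreal ((norm (w t - v t))\<^sup>2)) \<partial>lebesgue)"
    unfolding L2sq_def
  proof (rule nn_integral_mono)
    fix t
    have "ennreal ((norm (u t - v t))\<^sup>2) \<le> 2 * ennreal ((norm (u t - w t))\<^sup>2) + 2 * ennreal ((norm (w t - v t))\<^sup>2)"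
      using ennreal_leI[OF norm_diff_square_le[of "u t" "v t" "w t"]]
      by (simp add: ennreal_mult')
    then show "indicator S t * ennreal ((norm (u t - v t))\<^sup>2) \<le>
      2 * (indicator S t * ennreal ((norm (u t - w t))\<^sup>2)) +
      2 * (indicator S t * ennreal ((norm (w t - v t))\<^sup>2))"
      by (auto simp: indicator_def)
  qed
  also have "\<dots> = 2 * L2sq S (\<lambda>t. u t - w t) + 2 * L2sq S (\<lambda>t. w t - v t)"
    unfolding L2sq_def
    using L2sq_diff_measurable[OF assms(1,3) S] L2sq_diff_measurable[OF assms(3,2) S]
    by (simp add: nn_integral_add nn_integral_cmult borel_measurable_times)
  finally show ?thesis .
qed

lemma L2sq_minus_commute: "L2sq S (\<lambda>t. u t - v t) = L2sq S (\<lambda>t. v t - u t)"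
  unfolding L2sq_def by (simp add: norm_minus_commute)

lemma L2sq_mono_AE:
  assumes "AE t in lebesgue. t \<in> S \<longrightarrow> norm (u t) \<le> norm (v t)"
  shows "L2sq S u \<le> L2sq S v"
  unfolding L2sq_def
  by (rule nn_integral_mono_AE, rule eventually_mono[OF assms])
    (auto simp: indicator_def intro!: ennreal_leI power_mono)

lemma L2sq_cong_AE:
  assumes "AE t in lebesgue. t \<in> S \<longrightarrow> u t = v t"
  shows "L2sq S u = L2sq S v"
  by (intro antisym L2sq_mono_AE; rule eventually_mono[OF assms]) auto

lemma L2sq_Fatou:
  assumes f: "\<And>k. strongly_measurable_on S (f k)" and S: "S \<in> sets lebesgue"
    and lim: "AE t in lebesgue. t \<in> S \<longrightarrow> (\<lambda>k. f k t) \<longlonglongrightarrow> g t"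
  shows "L2sq S g \<le> liminf (\<lambda>k. L2sq S (f k))"
proof -
  have "L2sq S g \<le> (\<integral>\<^sup>+t. liminf (\<lambda>k. indicator S t * ennreal ((norm (f k t))\<^sup>2)) \<partial>lebesgue)"
    unfolding L2sq_def
  proof (rule nn_integral_mono_AE, rule eventually_mono[OF lim])
    fix t assume t: "t \<in> S \<longrightarrow> (\<lambda>k. f k t) \<longlonglongrightarrow> g t"
    show "indicator S t * ennreal ((norm (g t))\<^sup>2) \<le> liminf (\<lambda>k. indicator S t * ennreal ((norm (f k t))\<^sup>2))"
    proof (cases "t \<in> S")
      case True
      then have "(\<lambda>k. ennreal ((norm (f k t))\<^sup>2)) \<longlonglongrightarrow> ennreal ((norm (g t))\<^sup>2)"
        using t by (intro tendsto_ennrealI tendsto_intros) auto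
      from lim_imp_Liminf[OF _ this] show ?thesis using True by simp
    qed auto
  qed
  also have "\<dots> \<le> liminf (\<lambda>k. \<integral>\<^sup>+t. indicator S t * ennreal ((norm (f k t))\<^sup>2) \<partial>lebesgue)"
    by (rule nn_integral_liminf) (rule L2sq_measurable[OF f S])
  finally show ?thesis by (simp add: L2sq_def)
qed

text \<open>Fatou's lemma in the form in which it is applied: bounds that converge along the
  sequence pass to the almost everywhere limit.\<close>

lemma L2sq_le_of_AE_LIMSEQ:
  assumes f: "\<And>k. strongly_measurable_on S (f k)" and S: "S \<in> sets lebesgue"
    and lim: "AE t in lebesgue. t \<in> S \<longrightarrow> (\<lambda>k. f k t) \<longlonglongrightarrow> g t"
    and le: "\<And>k. L2sq S (f k) \<le> c k" and c: "c \<longlonglongrightarrow> C"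
  shows "L2sq S g \<le> C"
proof -
  have "L2sq S g \<le> liminf (\<lambda>k. L2sq S (f k))" by (rule L2sq_Fatou[OF f S lim])
  also have "\<dots> \<le> liminf c" by (intro Liminf_mono always_eventually allI le)
  also have "\<dots> = C" using c by (simp add: lim_imp_Liminf)
  finally show ?thesis .
qed

lemma L2sq_eq_0D:
  assumes "L2sq S (\<lambda>t. u t - v t) = 0" "strongly_measurable_on S u" "strongly_measurable_on S v"
    and S: "S \<in> sets lebesgue"
  shows "AE t in lebesgue. t \<in> S \<longrightarrow> u t = v t"
  using assms(1) unfolding L2sq_def nn_integral_0_iff_AE[OF L2sq_diff_measurable[OF assms(2-4)]]
  by eventually_elim (auto simp: indicator_def split: if_splits)

section \<open>Completeness of vector-valued square-integrable functions\<close>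

text \<open>Only differences are measured, so the notion makes sense before finiteness of the
  members is known. The bound is non-strict so that it survives Fatou's lemma.\<close>

definition L2_Cauchy :: "real set \<Rightarrow> (nat \<Rightarrow> real \<Rightarrow> 'h::real_normed_vector) \<Rightarrow> bool" where
  "L2_Cauchy S f \<longleftrightarrow> (\<forall>e>0. \<exists>N. \<forall>k\<ge>N. \<forall>l\<ge>N. L2sq S (\<lambda>t. f k t - f l t) \<le> ennreal e)"

lemma L2_CauchyI:
  assumes f: "\<And>k. strongly_measurable_on S (f k)" and g: "strongly_measurable_on S g"
    and S: "S \<in> sets lebesgue" and lim: "(\<lambda>k. L2sq S (\<lambda>t. f k t - g t)) \<longlonglongrightarrow> 0"
  shows "L2_Cauchy S f"
  unfolding L2_Cauchy_def
proof (intro allI impI)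
  fix e :: real assume e: "e > 0"
  \<comment> \<open>The squared triangle inequality doubles each of two terms, hence e / 4.\<close>
  then have "\<forall>\<^sub>F k in sequentially. L2sq S (\<lambda>t. f k t - g t) < ennreal (e / 4)"
    by (intro order_tendstoD[OF lim]) simp
  then obtain N where N: "\<And>k. k \<ge> N \<Longrightarrow> L2sq S (\<lambda>t. f k t - g t) < ennreal (e / 4)"
    unfolding eventually_sequentially by blast
  have "L2sq S (\<lambda>t. f k t - f l t) \<le> ennreal e" if "k \<ge> N" "l \<ge> N" for k l
  proof -
    have "L2sq S (\<lambda>t. f k t - f l t) \<le> 2 * L2sq S (\<lambda>t. f k t - g t) + 2 * L2sq S (\<lambda>t. g t - f l t)"
      by (rule L2sq_triangle[OF f f g S])
    also have "\<dots> \<le> 2 * ennreal (e / 4) + 2 * ennreal (e / 4)"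
      using N[OF that(1)] N[OF that(2)]
      by (intro add_mono mult_left_mono) (auto simp: L2sq_minus_commute[of S g])
    also have "2 * ennreal (e / 4) = ennreal (e / 2)"
      using e ennreal_mult[of 2 "e / 4"] by simp
    also have "ennreal (e / 2) + ennreal (e / 2) = ennreal e"
      using e ennreal_plus[of "e / 2" "e / 2"] by simp
    finally show ?thesis .
  qed
  then show "\<exists>N. \<forall>k\<ge>N. \<forall>l\<ge>N. L2sq S (\<lambda>t. f k t - f l t) \<le> ennreal e" by blast
qed

lemma L2_Cauchy_mono:
  assumes "L2_Cauchy S f" "\<And>k l. L2sq S (\<lambda>t. g k t - g l t) \<le> L2sq S (\<lambda>t. f k t - f l t)"
  shows "L2_Cauchy S g"
  using assms unfolding L2_Cauchy_def by (meson order_trans)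

lemma Cauchy_of_geometric_steps:
  fixes x :: "nat \<Rightarrow> 'a::real_normed_vector"
  assumes step: "\<And>j. norm (x (Suc j) - x j) \<le> K * (1 / 2) ^ j"
  shows "Cauchy x"
proof -
  \<comment> \<open>The subtracted term makes the induction close exactly:
    \<open>K * (1 / 2) ^ i\<close> is the difference of \<open>2 * K * (1 / 2) ^ i\<close> and the
    same expression at \<open>Suc i\<close>.\<close>
  have le: "norm (x m - x n) \<le> 2 * K * (1 / 2) ^ n - 2 * K * (1 / 2) ^ m" if "n \<le> m" for m n
    using that
  proof (induction m rule: dec_induct)
    case (step i)
    have "norm (x (Suc i) - x n) \<le> norm (x (Suc i) - x i) + norm (x i - x n)"
      using norm_triangle_ineq[of "x (Suc i) - x i" "x i - x n"] by simp
    then show ?case using step.IH assms[of i] by simp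
  qed simp
  have K: "K \<ge> 0" using order_trans[OF norm_ge_zero step[of 0]] by simp
  have "(\<lambda>n. 2 * K * (1 / 2) ^ n :: real) \<longlonglongrightarrow> 2 * K * 0"
    by (intro tendsto_intros LIMSEQ_power_zero) auto
  then have to0: "(\<lambda>n. 2 * K * (1 / 2) ^ n :: real) \<longlonglongrightarrow> 0" by simp
  show ?thesis
  proof (rule CauchyI)
    fix e :: real assume "e > 0"
    then obtain N where N: "\<And>n. n \<ge> N \<Longrightarrow> 2 * K * (1 / 2) ^ n < e"
      using order_tendstoD(2)[OF to0] unfolding eventually_sequentially by blast
    have main: "norm (x m - x n) < e" if "n \<ge> N" "n \<le> m" for m n
    proof -
      have "norm (x m - x n) \<le> 2 * K * (1 / 2) ^ n"
        using le[OF that(2)] K zero_le_power[of "1/2::real" m] mult_nonneg_nonneg[of "2 * K" "(1/2)^m"]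
        by linarith
      with N[OF that(1)] show ?thesis by linarith
    qed
    show "\<exists>M. \<forall>m\<ge>M. \<forall>n\<ge>M. norm (x m - x n) < e"
    proof (intro exI[of _ N] allI impI)
      fix m n assume "N \<le> m" "N \<le> n"
      then show "norm (x m - x n) < e"
        using main[of n m] main[of m n] by (cases "n \<le> m") (auto simp: norm_minus_commute)
    qed
  qed
qed

text \<open>The Riesz-Fischer argument. Squared steps of size 8^(-j), weighted by 4^j, still have
  summable integrals 2^(-j), so the weighted series is finite at almost every point. If its sum is
  \<open>K\<close>, the pointwise steps are at most \<open>sqrt K * (1 / 2) ^ j\<close>, and
  completeness of the value space applies.\<close>

lemma L2_Cauchy_AE_convergent_subseq:
  fixes f :: "nat \<Rightarrow> real \<Rightarrow> 'h::{real_normed_vector, complete_space}"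
  assumes f: "\<And>k. strongly_measurable_on S (f k)" and S: "S \<in> sets lebesgue" and C: "L2_Cauchy S f"
  shows "\<exists>r. strict_mono r \<and> (AE t in lebesgue. t \<in> S \<longrightarrow> convergent (\<lambda>j. f (r j) t))"
proof -
  have "\<exists>N. \<forall>k\<ge>N. \<forall>l\<ge>N. L2sq S (\<lambda>t. f k t - f l t) \<le> ennreal ((1 / 8) ^ j)" for j :: nat
    using C unfolding L2_Cauchy_def by simp
  then obtain N where N: "\<And>j k l. k \<ge> N j \<Longrightarrow> l \<ge> N j \<Longrightarrow>
      L2sq S (\<lambda>t. f k t - f l t) \<le> ennreal ((1 / 8) ^ j)"
    by metis
  \<comment> \<open>Summing \<open>Suc (N i)\<close> makes \<open>r\<close> strictly increasing and
    at least \<open>N j\<close> at the same time.\<close>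
  define r where "r j = (\<Sum>i\<le>j. Suc (N i))" for j
  have r: "strict_mono r"
    by (rule strict_monoI_Suc) (simp add: r_def)
  have rN: "N j \<le> r j" for j
    unfolding r_def by (rule order_trans[OF _ member_le_sum[of j]]) auto
  have rj: "L2sq S (\<lambda>t. f (r (Suc j)) t - f (r j) t) \<le> ennreal ((1 / 8) ^ j)" for j
    using rN[of j] strict_monoD[OF r, of j "Suc j"] by (intro N) auto
  define d where "d j t = ennreal (4 ^ j) * (indicator S t * ennreal ((norm (f (r (Suc j)) t - f (r j) t))\<^sup>2))" for j t
  have d: "d j \<in> borel_measurable lebesgue" for j
    unfolding d_def by (intro borel_measurable_times_ennreal L2sq_diff_measurable f S) auto
  have "(\<integral>\<^sup>+t. (\<Sum>j. d j t) \<partial>lebesgue) = (\<Sum>j. \<integral>\<^sup>+t. d j t \<partial>lebesgue)"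
    by (rule nn_integral_suminf[OF d])
  also have "\<dots> \<le> (\<Sum>j. ennreal ((1 / 2) ^ j))"
  proof (intro suminf_le summableI allI)
    fix j :: nat
    have "(\<integral>\<^sup>+t. d j t \<partial>lebesgue) = ennreal (4 ^ j) * L2sq S (\<lambda>t. f (r (Suc j)) t - f (r j) t)"
      unfolding d_def L2sq_def by (intro nn_integral_cmult L2sq_diff_measurable f S)
    also have "\<dots> \<le> ennreal (4 ^ j) * ennreal ((1 / 8) ^ j)"
      by (intro mult_left_mono rj) auto
    also have "\<dots> = ennreal ((1 / 2) ^ j)"
      by (simp add: ennreal_mult[symmetric] power_mult_distrib[symmetric])
    finally show "(\<integral>\<^sup>+t. d j t \<partial>lebesgue) \<le> ennreal ((1 / 2) ^ j)" .
  qed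
  also have "\<dots> < \<infinity>"
    by (subst suminf_ennreal2) (auto intro: summable_geometric)
  finally have fin: "AE t in lebesgue. (\<Sum>j. d j t) \<noteq> \<infinity>"
    by (intro nn_integral_PInf_AE borel_measurable_suminf_order d) auto
  have "convergent (\<lambda>j. f (r j) t)" if t: "(\<Sum>j. d j t) \<noteq> \<infinity>" "t \<in> S" for t
  proof -
    define K where "K = enn2real (\<Sum>j. d j t)"
    have "norm (f (r (Suc j)) t - f (r j) t) \<le> sqrt K * (1 / 2) ^ j" for j
    proof -
      let ?n = "norm (f (r (Suc j)) t - f (r j) t)"
      have "ennreal (4 ^ j * ?n\<^sup>2) = d j t"
        using t(2) by (simp add: d_def ennreal_mult)
      also have "\<dots> \<le> (\<Sum>j. d j t)"
        using sum_le_suminf[of "\<lambda>j. d j t" "{j}"] by (simp add: summableI)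
      also have "\<dots> = ennreal K"
        using t(1) by (simp add: K_def less_top)
      finally have "4 ^ j * ?n\<^sup>2 \<le> K"
        by (simp add: K_def)
      moreover have "4 ^ j * ?n\<^sup>2 = (2 ^ j * ?n)\<^sup>2"
        by (simp add: power_mult_distrib flip: power_mult) (simp add: power_mult mult.commute[of j])
      ultimately have "2 ^ j * ?n \<le> sqrt K"
        by (simp add: real_le_rsqrt)
      then show ?thesis by (simp add: field_simps)
    qed
    then have "Cauchy (\<lambda>j. f (r j) t)" by (rule Cauchy_of_geometric_steps)
    then show ?thesis by (rule Cauchy_convergent)
  qed
  with fin r show ?thesis by (intro exI[of _ r]) (auto elim!: eventually_mono)
qed

text \<open>With \<open>k\<close> fixed, Fatou's lemma in the second index of the Cauchy estimate
  replaces \<open>f l\<close> by \<open>g\<close>; the whole sequence converges, not only the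
  subsequence.\<close>

lemma L2sq_LIMSEQ_of_Cauchy:
  assumes f: "\<And>k. strongly_measurable_on S (f k)" and S: "S \<in> sets lebesgue" and C: "L2_Cauchy S f"
    and r: "strict_mono r" and lim: "AE t in lebesgue. t \<in> S \<longrightarrow> (\<lambda>j. f (r j) t) \<longlonglongrightarrow> g t"
  shows "(\<lambda>k. L2sq S (\<lambda>t. f k t - g t)) \<longlonglongrightarrow> 0"
proof (rule order_tendstoI)
  fix e :: ennreal assume "e > 0"
  \<comment> \<open>\<open>e\<close> may be infinite, so a positive real number below it is chosen
    first.\<close>
  then obtain e' where e': "0 < e'" "ennreal e' < e"
  proof -
    obtain x where x: "0 < x" "x < e" using dense[OF \<open>e > 0\<close>] by blast
    then show ?thesis using that[of "enn2real x"] by (cases x) (auto simp: enn2real_positive_iff less_top)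
  qed
  obtain N where N: "\<And>k l. k \<ge> N \<Longrightarrow> l \<ge> N \<Longrightarrow> L2sq S (\<lambda>t. f k t - f l t) \<le> ennreal e'"
    using C e'(1) unfolding L2_Cauchy_def by blast
  have "L2sq S (\<lambda>t. f k t - g t) \<le> ennreal e'" if k: "k \<ge> N" for k
  proof (rule L2sq_le_of_AE_LIMSEQ)
    \<comment> \<open>The shift by \<open>N\<close> puts every index \<open>r (N + j)\<close> into
      the range of the Cauchy estimate.\<close>
    show "AE t in lebesgue. t \<in> S \<longrightarrow> (\<lambda>j. f k t - f (r (N + j)) t) \<longlonglongrightarrow> f k t - g t"
      using lim
    proof eventually_elim
      case (elim t)
      then show ?case
        using LIMSEQ_ignore_initial_segment[of "\<lambda>j. f (r j) t" "g t" N]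
        by (auto intro!: tendsto_intros simp: add.commute)
    qed
    show "L2sq S (\<lambda>t. f k t - f (r (N + j)) t) \<le> ennreal e'" for j
      using seq_suble[OF r, of "N + j"] k by (intro N) auto
  qed (auto intro: strongly_measurable_on_diff f S)
  then show "\<forall>\<^sub>F k in sequentially. L2sq S (\<lambda>t. f k t - g t) < e"
    unfolding eventually_sequentially using e'(2) by (meson le_less_trans)
qed auto

section \<open>Sums of test functions\<close>

lemma test_fun_has_deriv:
  assumes "test_fun a b \<phi>"
  shows "(\<phi> has_real_derivative deriv \<phi> t) (at t)"
  using assms unfolding test_fun_def smooth_fun_def
  by (metis DERIV_deriv_iff_real_differentiable real_differentiable_def)

lemma test_fun_eq_0:
  assumes "test_fun a b \<phi>" "t \<notin> {a<..<b}"
  shows "\<phi> t = 0"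
proof -
  obtain c d where "a < c" "d < b" "\<And>t. t \<notin> {c..d} \<Longrightarrow> \<phi> t = 0"
    using assms(1) unfolding test_fun_def by blast
  then show ?thesis using assms(2) by auto
qed

lemma test_fun_deriv:
  assumes "test_fun a b \<phi>"
  shows "test_fun a b (deriv \<phi>)"
proof -
  obtain d where d: "d 0 = \<phi>" "\<And>k t. (d k has_real_derivative d (Suc k) t) (at t)"
    using assms unfolding test_fun_def smooth_fun_def by blast
  then have "deriv \<phi> = d (Suc 0)"
    by (metis DERIV_imp_deriv ext)
  with d(2) have "smooth_fun (deriv \<phi>)"
    unfolding smooth_fun_def by (intro exI[of _ "\<lambda>k. d (Suc k)"]) auto
  moreover obtain c e where ce: "a < c" "e < b" "\<And>t. t \<notin> {c..e} \<Longrightarrow> \<phi> t = 0"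
    using assms unfolding test_fun_def by blast
  have "deriv \<phi> t = 0" if "t \<notin> {c..e}" for t
  proof -
    \<comment> \<open>The complement of \<open>{c..e}\<close> is open, so the function vanishes near
      \<open>t\<close>; the same compact set serves for the derivative.\<close>
    have "(\<phi> has_real_derivative 0) (at t)"
      by (rule has_field_derivative_transform_within_open[of "\<lambda>_. 0" _ _ "- {c..e}"])
        (use that ce(3) in auto)
    then show ?thesis by (rule DERIV_imp_deriv)
  qed
  ultimately show ?thesis using ce(1,2) unfolding test_fun_def by blast
qed

text \<open>Terms are kept as a list instead of being merged into a function: differentiation acts
  on first components and operators on second components, so they commute as maps on lists, and
  properties follow by list induction.\<close>

definition test_sum :: "((real \<Rightarrow> real) \<times> 'h::real_vector) list \<Rightarrow> real \<Rightarrow> 'h" where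
  "test_sum ps t = sum_list (map (\<lambda>(\<phi>, f). \<phi> t *\<^sub>R f) ps)"

definition test_terms :: "real \<Rightarrow> real \<Rightarrow> 'h set \<Rightarrow> ((real \<Rightarrow> real) \<times> 'h) list \<Rightarrow> bool" where
  "test_terms a b D ps \<longleftrightarrow> (\<forall>(\<phi>, f)\<in>set ps. test_fun a b \<phi> \<and> f \<in> D)"

abbreviation deriv_terms :: "((real \<Rightarrow> real) \<times> 'h) list \<Rightarrow> ((real \<Rightarrow> real) \<times> 'h) list" where
  "deriv_terms \<equiv> map (apfst deriv)"

abbreviation image_terms :: "('h \<Rightarrow> 'k) \<Rightarrow> ((real \<Rightarrow> real) \<times> 'h) list \<Rightarrow> ((real \<Rightarrow> real) \<times> 'k) list" where
  "image_terms T \<equiv> map (apsnd T)"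

lemma test_sum_Nil [simp]: "test_sum [] t = 0"
  by (simp add: test_sum_def)

lemma test_sum_Cons [simp]: "test_sum (p # ps) t = fst p t *\<^sub>R snd p + test_sum ps t"
  by (simp add: test_sum_def split_beta)

lemma test_terms_Nil [simp]: "test_terms a b D []"
  by (simp add: test_terms_def)

lemma test_terms_Cons [simp]:
  "test_terms a b D (p # ps) \<longleftrightarrow> test_fun a b (fst p) \<and> snd p \<in> D \<and> test_terms a b D ps"
  by (auto simp: test_terms_def split_beta)

lemma test_terms_deriv: "test_terms a b D ps \<Longrightarrow> test_terms a b D (deriv_terms ps)"
  by (induction ps) (auto simp: test_fun_deriv)

lemma test_terms_image:
  "test_terms a b D ps \<Longrightarrow> (\<And>x. x \<in> D \<Longrightarrow> T x \<in> E) \<Longrightarrow> test_terms a b E (image_terms T ps)"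
  by (induction ps) auto

lemma test_sum_eq_0: "test_terms a b D ps \<Longrightarrow> t \<notin> {a<..<b} \<Longrightarrow> test_sum ps t = 0"
  by (induction ps) (auto simp: test_fun_eq_0 simp del: greaterThanLessThan_iff)

lemma test_sum_has_vector_derivative:
  fixes ps :: "((real \<Rightarrow> real) \<times> 'h::real_normed_vector) list"
  assumes "test_terms a b D ps"
  shows "(test_sum ps has_vector_derivative test_sum (deriv_terms ps) t) (at t)"
  using assms
proof (induction ps)
  case Nil
  have "test_sum ([] :: ((real \<Rightarrow> real) \<times> 'h) list) = (\<lambda>_. 0)" by auto
  then show ?case by simp
next
  case (Cons p ps)
  have "((\<lambda>t. fst p t *\<^sub>R snd p + test_sum ps t) has_vector_derivative
      deriv (fst p) t *\<^sub>R snd p + test_sum (deriv_terms ps) t) (at t)"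
    using Cons test_fun_has_deriv[of a b "fst p" t]
    by (intro has_vector_derivative_add) (auto intro!: derivative_eq_intros)
  moreover have "test_sum (p # ps) = (\<lambda>t. fst p t *\<^sub>R snd p + test_sum ps t)" by auto
  ultimately show ?case by simp
qed

lemma test_sum_continuous:
  fixes ps :: "((real \<Rightarrow> real) \<times> 'h::real_normed_vector) list"
  assumes "test_terms a b D ps"
  shows "continuous_on A (test_sum ps)"
  using test_sum_has_vector_derivative[OF assms]
  by (intro continuous_at_imp_continuous_on ballI has_vector_derivative_continuous)

lemma test_sum_strongly_measurable:
  fixes ps :: "((real \<Rightarrow> real) \<times> 'h::real_normed_vector) list"
  assumes "test_terms a b D ps"
  shows "strongly_measurable_on S (test_sum ps)"
  by (rule strongly_measurable_on_continuous[OF test_sum_continuous[OF assms], of a b])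
    (auto simp: test_sum_eq_0[OF assms])

lemma test_sum_mem: "test_terms a b D ps \<Longrightarrow> subspace D \<Longrightarrow> test_sum ps t \<in> D"
  by (induction ps) (auto simp: subspace_0 subspace_add subspace_scale)

text \<open>\<open>T\<close> is linear only on \<open>D\<close>, so the induction relies on every
  partial sum staying in the subspace.\<close>

lemma test_sum_image:
  assumes "test_terms a b D ps" "subspace D"
    and "\<And>x y. x \<in> D \<Longrightarrow> y \<in> D \<Longrightarrow> T (x + y) = T x + T y"
    and "\<And>x c. x \<in> D \<Longrightarrow> T (c *\<^sub>R x) = c *\<^sub>R T x"
  shows "test_sum (image_terms T ps) t = T (test_sum ps t)"
  using assms(1)
proof (induction ps)
  case Nil
  show ?case using assms(4)[OF subspace_0[OF assms(2)], of 0] by simp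
next
  case (Cons p ps)
  then show ?case
    using assms(2-4) by (auto simp: test_sum_mem subspace_scale)
qed

lemma test_sum_append: "test_sum (ps @ qs) t = test_sum ps t + test_sum qs t"
  by (induction ps) auto

lemma test_sum_uminus: "test_sum (image_terms uminus ps) t = - test_sum ps t"
  by (induction ps) auto

lemma test_terms_append: "test_terms a b D (ps @ qs) \<longleftrightarrow> test_terms a b D ps \<and> test_terms a b D qs"
  by (induction ps) auto

text \<open>Bridge from the extended-valued norm on the open interval to the gauge integral on the
  closed one, where the fundamental theorem of calculus is available; the endpoints form a null
  set.\<close>

lemma L2sq_continuous:
  assumes "continuous_on {a..b} u"
  shows "L2sq {a<..<b} u = ennreal (integral {a..b} (\<lambda>t. (norm (u t))\<^sup>2))"
proof -
  have "((\<lambda>t. (norm (u t))\<^sup>2) has_integral integral {a..b} (\<lambda>t. (norm (u t))\<^sup>2)) {a..b}"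
    using assms by (intro integrable_integral integrable_continuous_real continuous_intros)
  then have "((\<lambda>t. (norm (u t))\<^sup>2) has_integral integral {a..b} (\<lambda>t. (norm (u t))\<^sup>2)) {a<..<b}"
    by (simp add: has_integral_Icc_iff_Ioo)
  then have "integral\<^sup>N lborel (\<lambda>t. ennreal ((norm (u t))\<^sup>2) * indicator {a<..<b} t) =
      ennreal (integral {a..b} (\<lambda>t. (norm (u t))\<^sup>2))"
    by (intro nn_integral_has_integral_lebesgue') auto
  then show ?thesis
    by (simp add: L2sq_def nn_integral_completion mult.commute)
qed

lemma integral_norm_square_nonneg:
  fixes u :: "real \<Rightarrow> 'h::real_normed_vector"
  assumes "continuous_on {a..b} u"
  shows "0 \<le> integral {a..b} (\<lambda>t. (norm (u t))\<^sup>2)"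
  by (intro integral_nonneg integrable_continuous_real continuous_intros assms) simp

lemma L2sq_le_addI:
  fixes u :: "real \<Rightarrow> 'a::real_normed_vector" and v :: "real \<Rightarrow> 'b::real_normed_vector"
  assumes "continuous_on {a..b} u" "continuous_on {a..b} v"
    and "c \<le> integral {a..b} (\<lambda>t. (norm (u t))\<^sup>2) + integral {a..b} (\<lambda>t. (norm (v t))\<^sup>2)"
  shows "ennreal c \<le> L2sq {a<..<b} u + L2sq {a<..<b} v"
  unfolding L2sq_continuous[OF assms(1)] L2sq_continuous[OF assms(2)]
    ennreal_plus[OF integral_norm_square_nonneg[OF assms(1)] integral_norm_square_nonneg[OF assms(2)], symmetric]
  by (rule ennreal_leI[OF assms(3)])

section \<open>One-dimensional Sobolev inequalities without the interval length\<close>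

lemma norm_square_has_vector_derivative:
  fixes e :: "real \<Rightarrow> 'h::real_inner"
  assumes "(e has_vector_derivative e') (at t within S)"
  shows "((\<lambda>t. (norm (e t))\<^sup>2) has_vector_derivative 2 * inner (e t) e') (at t within S)"
  unfolding power2_norm_eq_inner
  by (rule has_vector_derivative_eq_rhs, rule bounded_bilinear.has_vector_derivative[OF bounded_bilinear_inner assms assms])
    (simp add: inner_commute)

text \<open>Since \<open>e\<close> vanishes at \<open>a\<close>, |e(t)|^2 is the integral of 2<e,e'>
  from \<open>a\<close> to \<open>t\<close>, and 2<e,e'> \<le> |e|^2 + |e'|^2.\<close>

lemma norm_square_le_integral:
  fixes e :: "real \<Rightarrow> 'h::real_inner"
  assumes e: "\<And>t. t \<in> {a..b} \<Longrightarrow> (e has_vector_derivative e' t) (at t within {a..b})"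
    and e': "continuous_on {a..b} e'" and 0: "e a = 0" and t: "t \<in> {a..b}"
  shows "(norm (e t))\<^sup>2 \<le> integral {a..b} (\<lambda>t. (norm (e t))\<^sup>2) + integral {a..b} (\<lambda>t. (norm (e' t))\<^sup>2)"
proof -
  have ce: "continuous_on {a..b} e"
    using e by (rule continuous_on_vector_derivative)
  have "((\<lambda>s. 2 * inner (e s) (e' s)) has_integral (norm (e t))\<^sup>2 - (norm (e a))\<^sup>2) {a..t}"
    using t by (intro fundamental_theorem_of_calculus norm_square_has_vector_derivative)
      (auto intro!: has_vector_derivative_within_subset[OF e])
  then have "integral {a..t} (\<lambda>s. 2 * inner (e s) (e' s)) = (norm (e t))\<^sup>2 - (norm (e a))\<^sup>2"
    by (rule integral_unique)
  then have "(norm (e t))\<^sup>2 = integral {a..t} (\<lambda>s. 2 * inner (e s) (e' s))"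
    using 0 by simp
  also have "\<dots> \<le> integral {a..t} (\<lambda>s. (norm (e s))\<^sup>2 + (norm (e' s))\<^sup>2)"
  proof (rule integral_le)
    show "2 * inner (e s) (e' s) \<le> (norm (e s))\<^sup>2 + (norm (e' s))\<^sup>2" for s
      using norm_cauchy_schwarz[of "e s" "e' s"] sum_squares_bound[of "norm (e s)" "norm (e' s)"]
      by linarith
  qed (use t in \<open>auto intro!: integrable_continuous_real continuous_intros
      continuous_on_subset[OF ce] continuous_on_subset[OF e']\<close>)
  also have "\<dots> \<le> integral {a..b} (\<lambda>s. (norm (e s))\<^sup>2 + (norm (e' s))\<^sup>2)"
    using t by (intro integral_subset_le)
      (auto intro!: integrable_continuous_real continuous_intros
        continuous_on_subset[OF ce] continuous_on_subset[OF e'])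
  also have "\<dots> = integral {a..b} (\<lambda>t. (norm (e t))\<^sup>2) + integral {a..b} (\<lambda>t. (norm (e' t))\<^sup>2)"
    by (intro integral_add integrable_continuous_real continuous_intros ce e')
  finally show ?thesis .
qed

text \<open>Integration by parts: the integral of |e'|^2 equals that of -<e,e''>, as the boundary
  term <e,e'> vanishes with \<open>e\<close> at both ends.\<close>

lemma integral_norm_deriv_le:
  fixes e :: "real \<Rightarrow> 'h::real_inner"
  assumes ab: "a \<le> b"
    and e: "\<And>t. t \<in> {a..b} \<Longrightarrow> (e has_vector_derivative e' t) (at t within {a..b})"
    and e': "\<And>t. t \<in> {a..b} \<Longrightarrow> (e' has_vector_derivative e'' t) (at t within {a..b})"
    and e'': "continuous_on {a..b} e''" and 0: "e a = 0" "e b = 0"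
  shows "integral {a..b} (\<lambda>t. (norm (e' t))\<^sup>2) \<le>
    integral {a..b} (\<lambda>t. (norm (e t))\<^sup>2) + integral {a..b} (\<lambda>t. (norm (e'' t))\<^sup>2)"
proof -
  have ce: "continuous_on {a..b} e" "continuous_on {a..b} e'"
    by (rule continuous_on_vector_derivative, erule e) (rule continuous_on_vector_derivative, erule e')
  have "((\<lambda>s. inner (e s) (e'' s) + inner (e' s) (e' s)) has_integral
      inner (e b) (e' b) - inner (e a) (e' a)) {a..b}"
    using ab by (intro fundamental_theorem_of_calculus
        bounded_bilinear.has_vector_derivative[OF bounded_bilinear_inner] e e')
  then have "0 = integral {a..b} (\<lambda>s. inner (e s) (e'' s) + inner (e' s) (e' s))"
    using 0 by (simp add: integral_unique)
  also have "\<dots> = integral {a..b} (\<lambda>s. inner (e s) (e'' s)) + integral {a..b} (\<lambda>s. inner (e' s) (e' s))"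
    by (intro integral_add integrable_continuous_real continuous_intros ce e'')
  finally have "integral {a..b} (\<lambda>t. (norm (e' t))\<^sup>2) = - integral {a..b} (\<lambda>s. inner (e s) (e'' s))"
    by (simp add: power2_norm_eq_inner)
  also have "\<dots> = integral {a..b} (\<lambda>s. - inner (e s) (e'' s))" by simp
  also have "\<dots> \<le> integral {a..b} (\<lambda>s. (norm (e s))\<^sup>2 + (norm (e'' s))\<^sup>2)"
  proof (rule integral_le)
    show "- inner (e s) (e'' s) \<le> (norm (e s))\<^sup>2 + (norm (e'' s))\<^sup>2" for s
      using Cauchy_Schwarz_ineq2[of "e s" "e'' s"] sum_squares_bound[of "norm (e s)" "norm (e'' s)"]
        mult_nonneg_nonneg[of "norm (e s)" "norm (e'' s)"] norm_ge_zero[of "e s"] norm_ge_zero[of "e'' s"]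
      by linarith
  qed (auto intro!: integrable_continuous_real continuous_intros ce e'')
  also have "\<dots> = integral {a..b} (\<lambda>t. (norm (e t))\<^sup>2) + integral {a..b} (\<lambda>t. (norm (e'' t))\<^sup>2)"
    by (intro integral_add integrable_continuous_real continuous_intros ce e'')
  finally show ?thesis .
qed

section \<open>Uniform and weak limits\<close>

lemma uniformly_Cauchy_of_L2_Cauchy:
  assumes f: "L2_Cauchy S f" and g: "L2_Cauchy S g"
    and le: "\<And>k l t. ennreal ((norm (h k t - h l t))\<^sup>2) \<le>
      2 * (L2sq S (\<lambda>t. f k t - f l t) + L2sq S (\<lambda>t. g k t - g l t))"
  shows "uniformly_Cauchy_on UNIV h"
proof (rule uniformly_Cauchy_onI)
  fix e :: real assume e: "e > 0"
  \<comment> \<open>Then 2 * (c + c) is e^2 / 2, strictly below e^2.\<close>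
  define c where "c = e\<^sup>2 / 8"
  have c: "c > 0" using e by (simp add: c_def)
  obtain N where N: "\<And>k l. k \<ge> N \<Longrightarrow> l \<ge> N \<Longrightarrow> L2sq S (\<lambda>t. f k t - f l t) \<le> ennreal c"
    using f c unfolding L2_Cauchy_def by blast
  obtain M where M: "\<And>k l. k \<ge> M \<Longrightarrow> l \<ge> M \<Longrightarrow> L2sq S (\<lambda>t. g k t - g l t) \<le> ennreal c"
    using g c unfolding L2_Cauchy_def by blast
  have "dist (h k t) (h l t) < e" if "k \<ge> max N M" "l \<ge> max N M" for k l t
  proof -
    have "ennreal ((norm (h k t - h l t))\<^sup>2) \<le> 2 * (ennreal c + ennreal c)"
      using that by (intro order_trans[OF le] mult_left_mono add_mono N M) auto
    also have "\<dots> = ennreal (4 * c)"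
      using c by (simp add: ennreal_mult' flip: ennreal_plus)
    finally have "(norm (h k t - h l t))\<^sup>2 \<le> 4 * c" using c by simp
    also have "\<dots> < e\<^sup>2" using e by (simp add: c_def)
    finally have "norm (h k t - h l t) < e"
      by (rule power_less_imp_less_base) (use e in simp)
    then show ?thesis by (simp add: dist_norm)
  qed
  then show "\<exists>M. \<forall>t\<in>UNIV. \<forall>k\<ge>M. \<forall>l\<ge>M. dist (h k t) (h l t) < e"
    by (intro exI[of _ "max N M"]) simp
qed

text \<open>The library's theorem on derivatives of sequences needs the sort banach, which
  real_inner + complete_space does not entail.\<close>

lemma uniform_limit_has_vector_derivative:
  fixes f :: "nat \<Rightarrow> real \<Rightarrow> 'h::real_normed_vector"
  assumes f: "\<And>k t. (f k has_vector_derivative f' k t) (at t)"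
    and cont: "\<And>k. continuous_on UNIV (f' k)"
    and lim: "\<And>t. (\<lambda>k. f k t) \<longlonglongrightarrow> F t" and lim': "uniform_limit UNIV f' F' sequentially"
  shows "(F has_vector_derivative F' x) (at x)"
  unfolding has_vector_derivative_def has_derivative_at_alt
proof (intro conjI allI impI)
  show "bounded_linear (\<lambda>h. h *\<^sub>R F' x)" by (rule bounded_linear_scaleR_left)
  fix e :: real assume e: "e > 0"
  \<comment> \<open>Continuity of the limit derivative supplies a radius \<open>d\<close> valid for
    all large \<open>k\<close> at once; on that ball \<open>f' k\<close> varies by at most e, in
    three parts of e / 3.\<close>
  have "continuous_on UNIV F'"
    by (rule uniform_limit_theorem[OF _ lim']) (auto simp: cont)
  then have "continuous (at x) F'"
    by (simp add: continuous_on_eq_continuous_at)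
  then obtain d where d: "d > 0" "\<And>s. dist s x < d \<Longrightarrow> dist (F' s) (F' x) < e / 3"
    unfolding continuous_at_eps_delta using e by (metis divide_pos_pos zero_less_numeral)
  have ev: "\<forall>\<^sub>F k in sequentially. \<forall>s\<in>UNIV. dist (f' k s) (F' s) < e / 3"
    by (rule uniform_limitD[OF lim']) (use e in simp)
  have "norm (F y - F x - (y - x) *\<^sub>R F' x) \<le> e * norm (y - x)" if y: "norm (y - x) < d" for y
  proof (rule Lim_norm_ubound[OF sequentially_bot])
    show "(\<lambda>k. f k y - f k x - (y - x) *\<^sub>R f' k x) \<longlonglongrightarrow> F y - F x - (y - x) *\<^sub>R F' x"
      by (intro tendsto_intros lim tendsto_uniform_limitI[OF lim']) auto
    show "\<forall>\<^sub>F k in sequentially. norm (f k y - f k x - (y - x) *\<^sub>R f' k x) \<le> e * norm (y - x)"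
      using ev
    proof eventually_elim
      case (elim k)
      have "norm (f k y - f k x - (y - x) *\<^sub>R f' k x) \<le> norm (y - x) * e"
      proof (rule vector_differentiable_bound_linearization)
        show "(f k has_vector_derivative f' k s) (at s within ball x d)" for s
          by (rule has_vector_derivative_at_within[OF f])
        show "closed_segment x y \<subseteq> ball x d"
          using y d(1) by (intro closed_segment_subset) (auto simp: dist_norm norm_minus_commute)
        show "norm (f' k s - f' k x) \<le> e" if "s \<in> ball x d" for s
        proof -
          have "dist (f' k s) (f' k x) \<le> dist (f' k s) (F' s) + dist (F' s) (F' x) + dist (F' x) (f' k x)"
            using dist_triangle[of "f' k s" "f' k x" "F' s"] dist_triangle[of "F' s" "f' k x" "F' x"] by linarith
          also have "\<dots> \<le> e / 3 + e / 3 + e / 3"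
            using elim d(2)[of s] that
            by (intro add_mono) (auto simp: dist_commute intro: less_imp_le)
          finally show ?thesis by (simp add: dist_norm)
        qed
      qed (use d(1) in auto)
      then show ?case by (simp add: mult.commute)
    qed
  qed
  then show "\<exists>d>0. \<forall>y. norm (y - x) < d \<longrightarrow> norm (F y - F x - (y - x) *\<^sub>R F' x) \<le> e * norm (y - x)"
    using d(1) by blast
qed

section \<open>Limits of integrals tested against a fixed vector\<close>

lemma L1_square_le_L2sq:
  fixes u :: "real \<Rightarrow> 'h::real_normed_vector"
  assumes u: "strongly_measurable_on {a<..<b} u" and ab: "a \<le> b"
  shows "(\<integral>\<^sup>+s. indicator {a<..<b} s * ennreal (norm (u s)) \<partial>lebesgue)\<^sup>2 \<le> L2sq {a<..<b} u * ennreal (b - a)"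
proof -
  let ?I = "indicator {a<..<b} :: real \<Rightarrow> ennreal"
  have "(\<lambda>s. indicator {a<..<b} s * norm (u s)) \<in> borel_measurable lebesgue"
    by (rule strongly_measurable_on_measurable2[OF u u]) (auto simp: split_beta intro!: continuous_intros)
  then have "(\<lambda>s. ennreal (indicator {a<..<b} s * norm (u s))) \<in> borel_measurable lebesgue"
    by (rule measurable_compose[OF _ measurable_ennreal])
  moreover have "ennreal (indicator {a<..<b} s * norm (u s)) = ?I s * ennreal (norm (u s))" for s
    by (cases "s \<in> {a<..<b}") auto
  ultimately have meas: "(\<lambda>s. ?I s * ennreal (norm (u s))) \<in> borel_measurable lebesgue"
    by (simp only:)
  have "(\<integral>\<^sup>+s. ?I s * ennreal (norm (u s)) \<partial>lebesgue)\<^sup>2 =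
      (\<integral>\<^sup>+s. (?I s * ennreal (norm (u s))) * ?I s \<partial>lebesgue)\<^sup>2"
    by (intro arg_cong[of _ _ "\<lambda>x. x\<^sup>2"] nn_integral_cong) (auto simp: indicator_def)
  \<comment> \<open>Cauchy-Schwarz against the constant 1. The length \<open>b - a\<close> that
    results serves integrability and convergence, and does not reach the final bounds.\<close>
  also have "\<dots> \<le> (\<integral>\<^sup>+s. (?I s * ennreal (norm (u s)))\<^sup>2 \<partial>lebesgue) * (\<integral>\<^sup>+s. (?I s)\<^sup>2 \<partial>lebesgue)"
    by (rule Cauchy_Schwarz_nn_integral[OF meas borel_measurable_indicator]) simp
  also have "(\<integral>\<^sup>+s. (?I s * ennreal (norm (u s)))\<^sup>2 \<partial>lebesgue) = L2sq {a<..<b} u"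
    unfolding L2sq_def by (intro nn_integral_cong) (auto simp: indicator_def ennreal_power)
  also have "(\<integral>\<^sup>+s. (?I s)\<^sup>2 \<partial>lebesgue) = (\<integral>\<^sup>+s. ?I s \<partial>lebesgue)"
    by (intro nn_integral_cong) (auto simp: indicator_def)
  also have "\<dots> = ennreal (b - a)"
    using ab by simp
  finally show ?thesis .
qed

lemma AE_lebesgue_neq: "AE s in lebesgue. s \<noteq> (a :: real)"
  by (rule AE_completion) (rule AE_lborel_singleton)

lemma nn_integral_inner_le:
  fixes u :: "real \<Rightarrow> 'h::real_inner"
  assumes t: "t \<in> {a..b}" and u: "strongly_measurable_on UNIV u"
  shows "(\<integral>\<^sup>+s. ennreal (norm (indicat_real {a..t} s *\<^sub>R inner (u s) h)) \<partial>lebesgue)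
    \<le> ennreal (norm h) * (\<integral>\<^sup>+s. indicator {a<..<b} s * ennreal (norm (u s)) \<partial>lebesgue)"
proof -
  have "(\<lambda>s. ennreal (indicator {a<..<b} s * norm (u s))) \<in> borel_measurable lebesgue"
    by (rule measurable_compose[OF strongly_measurable_on_measurable2[of _ u u] measurable_ennreal])
      (auto simp: split_beta intro!: continuous_intros strongly_measurable_on_subset[OF u])
  moreover have "ennreal (indicator {a<..<b} s * norm (u s)) = indicator {a<..<b} s * ennreal (norm (u s))" for s
    by (cases "s \<in> {a<..<b}") auto
  ultimately have meas: "(\<lambda>s. indicator {a<..<b} s * ennreal (norm (u s))) \<in> borel_measurable lebesgue"
    by (simp only:)
  have "(\<integral>\<^sup>+s. ennreal (norm (indicat_real {a..t} s *\<^sub>R inner (u s) h)) \<partial>lebesgue) \<le>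
      (\<integral>\<^sup>+s. ennreal (norm h) * (indicator {a<..<b} s * ennreal (norm (u s))) \<partial>lebesgue)"
  proof (rule nn_integral_mono_AE)
    \<comment> \<open>The interval \<open>{a..t}\<close> lies in \<open>{a<..<b}\<close> up to the
      two endpoints, which are null.\<close>
    show "AE s in lebesgue. ennreal (norm (indicat_real {a..t} s *\<^sub>R inner (u s) h))
        \<le> ennreal (norm h) * (indicator {a<..<b} s * ennreal (norm (u s)))"
      using AE_lebesgue_neq[of a] AE_lebesgue_neq[of b]
    proof eventually_elim
      case (elim s)
      show ?case
      proof (cases "s \<in> {a..t}")
        case True
        then have "s \<in> {a<..<b}" using elim t by auto
        then show ?thesis using True Cauchy_Schwarz_ineq2[of "u s" h]
          by (simp add: ennreal_mult'[symmetric] mult.commute ennreal_leI)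
      qed auto
    qed
  qed
  also have "\<dots> = ennreal (norm h) * (\<integral>\<^sup>+s. indicator {a<..<b} s * ennreal (norm (u s)) \<partial>lebesgue)"
    by (rule nn_integral_cmult[OF meas])
  finally show ?thesis .
qed

lemma integrable_indicator_inner:
  fixes u :: "real \<Rightarrow> 'h::real_inner"
  assumes t: "t \<in> {a..b}" and u: "strongly_measurable_on UNIV u" and fin: "L2sq {a<..<b} u < \<infinity>"
  shows "integrable lebesgue (\<lambda>s. indicat_real {a..t} s *\<^sub>R inner (u s) h)"
proof (rule integrableI_bounded)
  show "(\<lambda>s. indicat_real {a..t} s *\<^sub>R inner (u s) h) \<in> borel_measurable lebesgue"
    using strongly_measurable_on_measurable2[of "{a..t}" u u "\<lambda>x _. inner x h"]
      strongly_measurable_on_subset[OF u, of "{a..t}"]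
    by (simp add: split_beta continuous_intros)
  let ?N = "\<integral>\<^sup>+s. indicator {a<..<b} s * ennreal (norm (u s)) \<partial>lebesgue"
  have "?N\<^sup>2 \<le> L2sq {a<..<b} u * ennreal (b - a)"
    using t by (intro L1_square_le_L2sq strongly_measurable_on_subset[OF u]) auto
  also have "\<dots> < \<infinity>" using fin by (simp add: ennreal_mult_less_top)
  finally have "?N < \<infinity>" by (cases "?N = \<infinity>") (auto simp: less_top)
  then have "ennreal (norm h) * ?N < \<infinity>" by (simp add: ennreal_mult_less_top)
  with nn_integral_inner_le[OF t u, of h]
  show "(\<integral>\<^sup>+s. ennreal (norm (indicat_real {a..t} s *\<^sub>R inner (u s) h)) \<partial>lebesgue) < \<infinity>"
    by (rule le_less_trans)
qed

text \<open>On a bounded interval L^2 convergence implies L^1 convergence, and pairing with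
  \<open>h\<close> costs at most the factor \<open>norm h\<close>.\<close>

lemma set_integral_inner_tendsto:
  fixes f :: "nat \<Rightarrow> real \<Rightarrow> 'h::real_inner"
  assumes t: "t \<in> {a..b}" and f: "\<And>k. strongly_measurable_on UNIV (f k)" and g: "strongly_measurable_on UNIV g"
    and fin: "\<And>k. L2sq {a<..<b} (f k) < \<infinity>" "L2sq {a<..<b} g < \<infinity>"
    and lim: "(\<lambda>k. L2sq {a<..<b} (\<lambda>s. f k s - g s)) \<longlonglongrightarrow> 0"
  shows "(\<lambda>k. LINT s:{a..t}|lebesgue. inner (f k s) h) \<longlonglongrightarrow> (LINT s:{a..t}|lebesgue. inner (g s) h)"
  unfolding set_lebesgue_integral_def
proof (rule tendsto_L1_int)
  show "integrable lebesgue (\<lambda>s. indicat_real {a..t} s *\<^sub>R inner (f k s) h)" for k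
    by (rule integrable_indicator_inner[OF t f fin(1)])
  show "integrable lebesgue (\<lambda>s. indicat_real {a..t} s *\<^sub>R inner (g s) h)"
    by (rule integrable_indicator_inner[OF t g fin(2)])
  define N where "N k = (\<integral>\<^sup>+s. indicator {a<..<b} s * ennreal (norm (f k s - g s)) \<partial>lebesgue)" for k
  have N: "(N k)\<^sup>2 \<le> L2sq {a<..<b} (\<lambda>s. f k s - g s) * ennreal (b - a)" for k
    unfolding N_def using t
    by (intro L1_square_le_L2sq strongly_measurable_on_diff)
      (auto intro: strongly_measurable_on_subset[OF f] strongly_measurable_on_subset[OF g])
  have "(\<lambda>k. ennreal (b - a) * L2sq {a<..<b} (\<lambda>s. f k s - g s)) \<longlonglongrightarrow> ennreal (b - a) * 0"
    by (intro ennreal_tendsto_cmult lim) auto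
  then have "(\<lambda>k. L2sq {a<..<b} (\<lambda>s. f k s - g s) * ennreal (b - a)) \<longlonglongrightarrow> 0"
    by (simp add: mult.commute)
  from tendsto_sandwich[OF _ _ tendsto_const this]
  have lim2: "(\<lambda>k. (N k)\<^sup>2) \<longlonglongrightarrow> 0" using N by simp
  \<comment> \<open>The square root is taken through the order: \<open>e \<le> N k\<close> would
    force the square of \<open>e\<close> below that of \<open>N k\<close>.\<close>
  have "N \<longlonglongrightarrow> 0"
  proof (rule order_tendstoI)
    fix e :: ennreal assume "0 < e"
    then have "0 < e\<^sup>2" by (simp add: zero_less_iff_neq_zero)
    from order_tendstoD(2)[OF lim2 this] show "\<forall>\<^sub>F k in sequentially. N k < e"
    proof eventually_elim
      case (elim k)
      show ?case
      proof (rule ccontr)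
        assume "\<not> N k < e"
        then have "e\<^sup>2 \<le> (N k)\<^sup>2" by (intro power_mono) auto
        with elim show False by simp
      qed
    qed
  qed auto
  then have "(\<lambda>k. ennreal (norm h) * N k) \<longlonglongrightarrow> ennreal (norm h) * 0"
    by (intro ennreal_tendsto_cmult) auto
  then have lim3: "(\<lambda>k. ennreal (norm h) * N k) \<longlonglongrightarrow> 0" by simp
  have "(\<integral>\<^sup>+s. ennreal (norm (indicat_real {a..t} s *\<^sub>R inner (f k s) h - indicat_real {a..t} s *\<^sub>R inner (g s) h)) \<partial>lebesgue)
      \<le> ennreal (norm h) * N k" for k
    using nn_integral_inner_le[OF t strongly_measurable_on_diff[OF f g], of k h]
    by (simp add: N_def inner_diff_left algebra_simps)
  then show "(\<lambda>k. \<integral>\<^sup>+s. ennreal (norm (indicat_real {a..t} s *\<^sub>R inner (f k s) h -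
      indicat_real {a..t} s *\<^sub>R inner (g s) h)) \<partial>lebesgue) \<longlonglongrightarrow> 0"
    by (intro tendsto_sandwich[OF always_eventually always_eventually tendsto_const lim3] allI) simp_all
qed

section \<open>The differential expression with a positive definite operator\<close>

locale pos_def_operator =
  fixes J :: "'h::{real_inner, complete_space} \<Rightarrow> 'h" and Hs D :: "'h set" and A :: "'h \<Rightarrow> 'h"
  assumes J: "complex_structure J" and Hs: "complex_hilbert_subspace J Hs"
    and A: "pos_def_selfadjoint J Hs D A"
begin

lemma J_linear: "linear J" and J_J: "J (J x) = - x" and J_isometry: "inner (J x) (J y) = inner x y"
  using J by (auto simp: complex_structure_def)

lemma J_adjoint: "inner (J x) y = - inner x (J y)"
  using J_isometry[of x "J y"] J_J[of y] by (simp add: inner_minus_right)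

lemma norm_J: "norm (J x) = norm x"
  by (simp add: norm_eq_sqrt_inner J_isometry)

lemma D_subspace: "subspace D" and D_subset: "D \<subseteq> Hs"
  and A_mem: "x \<in> D \<Longrightarrow> A x \<in> Hs"
  and A_add: "x \<in> D \<Longrightarrow> y \<in> D \<Longrightarrow> A (x + y) = A x + A y"
  and A_scale: "x \<in> D \<Longrightarrow> A (c *\<^sub>R x) = c *\<^sub>R A x"
  and A_J: "x \<in> D \<Longrightarrow> A (J x) = J (A x)"
  and J_D: "x \<in> D \<Longrightarrow> J x \<in> D"
  and A_symmetric: "x \<in> D \<Longrightarrow> y \<in> D \<Longrightarrow> inner (A x) y = inner x (A y)"
  using A by (auto simp: pos_def_selfadjoint_def)

lemma A_uminus: "x \<in> D \<Longrightarrow> A (- x) = - A x"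
  using A_scale[of x "-1"] by simp

lemma Hs_subspace: "subspace Hs" and Hs_closed: "closed Hs"
  using Hs by (auto simp: complex_hilbert_subspace_def)

text \<open>\<open>inner\<close> is the real part of the complex inner product. Commutation with
  \<open>J\<close>, symmetry of \<open>A\<close> and skewness of \<open>J\<close> turn the quantity
  into its own negative.\<close>

lemma inner_J_A_self: "x \<in> D \<Longrightarrow> inner x (J (A x)) = 0"
  using A_symmetric[of x "J x"] J_adjoint[of x "A x"] J_adjoint[of "A x" x] A_J[of x] J_D[of x]
  by (simp add: inner_commute)

text \<open>A selfadjoint operator is closed, being equal to its adjoint. Passing to the limit in
  the symmetry relation puts \<open>z\<close> into the domain of the adjoint, hence into
  \<open>D\<close>; density of \<open>D\<close> in \<open>Hs\<close> then identifies
  \<open>A z\<close> with \<open>y\<close>.\<close>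

lemma A_closed:
  assumes x: "\<And>k. x k \<in> D" and lim: "x \<longlonglongrightarrow> z" and Alim: "(\<lambda>k. A (x k)) \<longlonglongrightarrow> y"
  shows "z \<in> D" "A z = y"
proof -
  have z: "z \<in> Hs"
    by (rule closed_sequentially[OF Hs_closed _ lim]) (use x D_subset in auto)
  have y: "y \<in> Hs"
    by (rule closed_sequentially[OF Hs_closed _ Alim]) (use x A_mem in auto)
  have eq: "inner (A w) z = inner w y" if "w \<in> D" for w
  proof (rule LIMSEQ_unique)
    show "(\<lambda>k. inner (A w) (x k)) \<longlonglongrightarrow> inner (A w) z" by (intro tendsto_intros lim)
    show "(\<lambda>k. inner (A w) (x k)) \<longlonglongrightarrow> inner w y"
      using A_symmetric[OF that x] tendsto_inner[OF tendsto_const Alim, of w] by simp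
  qed
  show zD: "z \<in> D"
    using A z y eq unfolding pos_def_selfadjoint_def by blast
  have "inner w (A z - y) = 0" if "w \<in> D" for w
    using eq[OF that] A_symmetric[OF that zD] by (simp add: inner_diff_right)
  then have "D \<subseteq> {w. inner w (A z - y) = 0}" by blast
  then have "closure D \<subseteq> {w. inner w (A z - y) = 0}"
    by (rule closure_minimal) (simp add: closed_hyperplane inner_commute[of _ "A z - y"])
  moreover have "A z - y \<in> closure D"
    using A A_mem[OF zD] y subspace_diff[OF Hs_subspace] unfolding pos_def_selfadjoint_def by blast
  ultimately have "inner (A z - y) (A z - y) = 0" by blast
  then show "A z = y" by simp
qed

text \<open>The differential expression \<open>l(p) = - p'' + i A p\<close> on a test sum.\<close>

definition expr_sum :: "((real \<Rightarrow> real) \<times> 'h) list \<Rightarrow> real \<Rightarrow> 'h" where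
  "expr_sum ps t = - test_sum (deriv_terms (deriv_terms ps)) t + J (test_sum (image_terms A ps) t)"

lemma lpre_graph_eq: "lpre_graph a b J D A = {(test_sum ps, expr_sum ps) | ps. test_terms a b D ps}"
proof -
  have "(\<lambda>t. sum_list (map (\<lambda>(\<phi>, f). (- deriv (deriv \<phi>) t) *\<^sub>R f + \<phi> t *\<^sub>R J (A f)) ps)) = expr_sum ps" for ps
  proof
    show "sum_list (map (\<lambda>(\<phi>, f). (- deriv (deriv \<phi>) t) *\<^sub>R f + \<phi> t *\<^sub>R J (A f)) ps) = expr_sum ps t" for t
      by (induction ps) (auto simp: expr_sum_def linear_0[OF J_linear] linear_add[OF J_linear]
          linear_scale[OF J_linear] algebra_simps split_beta)
  qed
  moreover have "(\<lambda>t. sum_list (map (\<lambda>(\<phi>, f). \<phi> t *\<^sub>R f) ps)) = test_sum ps" for ps :: "((real \<Rightarrow> real) \<times> 'h) list"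
    by (auto simp: test_sum_def)
  ultimately show ?thesis
    by (simp add: lpre_graph_def test_terms_def)
qed

lemma test_sum_A: "test_terms a b D ps \<Longrightarrow> test_sum (image_terms A ps) t = A (test_sum ps t)"
  by (rule test_sum_image) (auto intro: D_subspace A_add A_scale)

lemma test_sum_J: "J (test_sum ps t) = test_sum (image_terms J ps) t"
  by (induction ps) (auto simp: linear_0[OF J_linear] linear_add[OF J_linear] linear_scale[OF J_linear])

lemma test_terms_A: "test_terms a b D ps \<Longrightarrow> test_terms a b Hs (image_terms A ps)"
  by (rule test_terms_image) (auto intro: A_mem)

lemma test_terms_J: "test_terms a b E ps \<Longrightarrow> test_terms a b UNIV (image_terms J ps)"
  by (rule test_terms_image) auto

text \<open>Lets every estimate for one test sum be applied to the difference of two, which is what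
  Cauchy arguments require. The list is \<open>ps\<close> followed by \<open>qs\<close> with negated
  vectors.\<close>

lemma test_terms_diff:
  assumes "test_terms a b D ps" "test_terms a b D qs"
  obtains rs where "test_terms a b D rs"
    "\<And>t. test_sum rs t = test_sum ps t - test_sum qs t"
    "\<And>t. test_sum (deriv_terms rs) t = test_sum (deriv_terms ps) t - test_sum (deriv_terms qs) t"
    "\<And>t. test_sum (deriv_terms (deriv_terms rs)) t =
      test_sum (deriv_terms (deriv_terms ps)) t - test_sum (deriv_terms (deriv_terms qs)) t"
    "\<And>t. test_sum (image_terms A rs) t = test_sum (image_terms A ps) t - test_sum (image_terms A qs) t"
    "\<And>t. expr_sum rs t = expr_sum ps t - expr_sum qs t"
proof
  let ?rs = "ps @ image_terms uminus qs"
  show "test_terms a b D ?rs"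
    using assms test_terms_image[of a b D qs uminus D] subspace_neg[OF D_subspace]
    by (auto simp: test_terms_append)
  have *: "test_sum (deriv_terms (image_terms uminus qs)) t = - test_sum (deriv_terms qs) t"
    for qs :: "((real \<Rightarrow> real) \<times> 'h) list" and t
    by (induction qs) auto
  have **: "test_sum (deriv_terms (deriv_terms (image_terms uminus qs))) t = - test_sum (deriv_terms (deriv_terms qs)) t"
    for qs :: "((real \<Rightarrow> real) \<times> 'h) list" and t
    by (induction qs) auto
  have A: "test_sum (image_terms A (image_terms uminus qs)) t = - test_sum (image_terms A qs) t" for t
    using assms(2) by (induction qs) (auto simp: A_uminus)
  show "test_sum ?rs t = test_sum ps t - test_sum qs t" for t
    unfolding test_sum_append test_sum_uminus by simp
  show "test_sum (deriv_terms ?rs) t = test_sum (deriv_terms ps) t - test_sum (deriv_terms qs) t" for t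
    unfolding map_append test_sum_append * by simp
  show 2: "test_sum (deriv_terms (deriv_terms ?rs)) t =
      test_sum (deriv_terms (deriv_terms ps)) t - test_sum (deriv_terms (deriv_terms qs)) t" for t
    unfolding map_append test_sum_append ** by simp
  show 3: "test_sum (image_terms A ?rs) t = test_sum (image_terms A ps) t - test_sum (image_terms A qs) t" for t
    unfolding map_append test_sum_append A by simp
  show "expr_sum ?rs t = expr_sum ps t - expr_sum qs t" for t
    unfolding expr_sum_def 2 3 by (simp add: linear_diff[OF J_linear])
qed

lemma expr_sum_continuous:
  assumes "test_terms a b D ps"
  shows "continuous_on X (expr_sum ps)"
  unfolding expr_sum_def test_sum_J
  by (intro continuous_intros test_sum_continuous[of a b D] test_sum_continuous[of a b UNIV]
      test_terms_deriv assms test_terms_J[OF test_terms_A[OF assms]])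

lemma expr_sum_strongly_measurable:
  assumes "test_terms a b D ps"
  shows "strongly_measurable_on X (expr_sum ps)"
proof (rule strongly_measurable_on_continuous[OF expr_sum_continuous[OF assms], of a b])
  show "expr_sum ps t = 0" if "t \<notin> {a..b}" for t
    using that test_sum_eq_0[OF test_terms_deriv[OF test_terms_deriv[OF assms]], of t]
      test_sum_eq_0[OF test_terms_A[OF assms], of t]
    by (auto simp: expr_sum_def linear_0[OF J_linear])
qed

text \<open>The cross term \<open>\<langle>p'', i A p\<rangle>\<close> is the derivative of \<open>\<langle>p', i A p\<rangle>\<close>, because
  \<open>\<langle>p', i A p'\<rangle> = 0\<close> pointwise, so it integrates to zero.\<close>

lemma L2sq_expr_sum:
  assumes ab: "a \<le> b" and ps: "test_terms a b D ps"
  shows "L2sq {a<..<b} (expr_sum ps) =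
    L2sq {a<..<b} (test_sum (deriv_terms (deriv_terms ps))) + L2sq {a<..<b} (test_sum (image_terms A ps))"
proof -
  \<comment> \<open>Prevents the simplifier from fusing nested \<open>deriv_terms\<close> and
    \<open>image_terms\<close> into one map, where the facts about them would no longer
    match.\<close>
  note [simp del] = map_map
  let ?p1 = "test_sum (deriv_terms ps)" and ?p2 = "test_sum (deriv_terms (deriv_terms ps))"
  let ?pA = "test_sum (image_terms A ps)" and ?pJ = "test_sum (image_terms J (image_terms A ps))"
  note tt = ps test_terms_deriv[OF ps] test_terms_deriv[OF test_terms_deriv[OF ps]]
  note tA = test_terms_A[OF ps] and tJ = test_terms_J[OF test_terms_A[OF ps]]
  have cont: "continuous_on {a..b} ?p2" "continuous_on {a..b} ?pA" "continuous_on {a..b} ?pJ"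
    using tt(3) tA tJ by (auto intro: test_sum_continuous)
  have "((\<lambda>t. inner (?p1 t) (?pJ t)) has_vector_derivative inner (?p2 t) (?pJ t)) (at t within {a..b})" for t
  proof -
    \<comment> \<open>Derivative and operators act on different components of each term, so the
      derivative of i A p is i A p'.\<close>
    have "deriv_terms (image_terms J (image_terms A ps)) = image_terms J (image_terms A (deriv_terms ps))"
      by (simp add: map_map)
    then have "test_sum (deriv_terms (image_terms J (image_terms A ps))) t = J (A (?p1 t))"
      by (simp only: test_sum_J[symmetric] test_sum_A[OF tt(2)])
    then have "inner (?p1 t) (test_sum (deriv_terms (image_terms J (image_terms A ps))) t) = 0"
      using inner_J_A_self[OF test_sum_mem[OF tt(2) D_subspace], of t] by simp
    then have "((\<lambda>t. inner (?p1 t) (?pJ t)) has_vector_derivative inner (?p2 t) (?pJ t)) (at t)"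
      using bounded_bilinear.has_vector_derivative[OF bounded_bilinear_inner
          test_sum_has_vector_derivative[OF tt(2)] test_sum_has_vector_derivative[OF tJ], of t] by simp
    then show ?thesis by (rule has_vector_derivative_at_within)
  qed
  then have "((\<lambda>t. inner (?p2 t) (?pJ t)) has_integral inner (?p1 b) (?pJ b) - inner (?p1 a) (?pJ a)) {a..b}"
    using ab by (intro fundamental_theorem_of_calculus) auto
  moreover have "?p1 a = 0" "?p1 b = 0" by (auto intro!: test_sum_eq_0[OF tt(2)])
  ultimately have cross: "integral {a..b} (\<lambda>t. inner (?p2 t) (?pJ t)) = 0"
    by (auto intro: integral_unique)
  have "integral {a..b} (\<lambda>t. (norm (expr_sum ps t))\<^sup>2) =
      integral {a..b} (\<lambda>t. ((norm (?p2 t))\<^sup>2 + (norm (?pA t))\<^sup>2) - 2 * inner (?p2 t) (?pJ t))"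
  proof (rule integral_cong)
    fix t
    have "(norm (expr_sum ps t))\<^sup>2 = (norm (?p2 t))\<^sup>2 + (norm (J (?pA t)))\<^sup>2 - 2 * inner (?p2 t) (J (?pA t))"
      unfolding expr_sum_def power2_norm_eq_inner by (simp add: inner_simps inner_commute)
    then show "(norm (expr_sum ps t))\<^sup>2 = ((norm (?p2 t))\<^sup>2 + (norm (?pA t))\<^sup>2) - 2 * inner (?p2 t) (?pJ t)"
      unfolding norm_J unfolding test_sum_J .
  qed
  also have "\<dots> = integral {a..b} (\<lambda>t. (norm (?p2 t))\<^sup>2 + (norm (?pA t))\<^sup>2) -
      integral {a..b} (\<lambda>t. 2 * inner (?p2 t) (?pJ t))"
    by (intro integral_diff integrable_continuous_real continuous_intros cont)
  also have "\<dots> = integral {a..b} (\<lambda>t. (norm (?p2 t))\<^sup>2) + integral {a..b} (\<lambda>t. (norm (?pA t))\<^sup>2)"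
    using cross by (subst integral_add) (auto intro!: integrable_continuous_real continuous_intros cont)
  finally show ?thesis
    by (simp add: L2sq_continuous[OF expr_sum_continuous[OF ps]] L2sq_continuous[OF cont(1)]
        L2sq_continuous[OF cont(2)] integral_nonneg integrable_continuous_real continuous_intros cont)
qed

section \<open>Sobolev bounds for test sums\<close>

lemma L2sq_deriv_le:
  assumes ab: "a \<le> b" and ps: "test_terms a b D ps"
  shows "L2sq {a<..<b} (test_sum (deriv_terms ps)) \<le>
    L2sq {a<..<b} (test_sum ps) + L2sq {a<..<b} (test_sum (deriv_terms (deriv_terms ps)))"
proof -
  note tt = ps test_terms_deriv[OF ps] test_terms_deriv[OF test_terms_deriv[OF ps]]
  note cont = test_sum_continuous[OF tt(1)] test_sum_continuous[OF tt(2)] test_sum_continuous[OF tt(3)]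
  have "integral {a..b} (\<lambda>t. (norm (test_sum (deriv_terms ps) t))\<^sup>2) \<le>
      integral {a..b} (\<lambda>t. (norm (test_sum ps t))\<^sup>2) +
      integral {a..b} (\<lambda>t. (norm (test_sum (deriv_terms (deriv_terms ps)) t))\<^sup>2)"
    by (rule integral_norm_deriv_le[OF ab
          has_vector_derivative_at_within[OF test_sum_has_vector_derivative[OF tt(1)]]
          has_vector_derivative_at_within[OF test_sum_has_vector_derivative[OF tt(2)]] cont(3)])
      (simp_all add: test_sum_eq_0[OF ps])
  then show ?thesis
    unfolding L2sq_continuous[OF cont(2)] by (rule L2sq_le_addI[OF cont(1) cont(3)])
qed

text \<open>Test sums vanish outside the interval, so \<open>t\<close> ranges over the whole line;
  this later gives uniform convergence on \<open>UNIV\<close>, endpoints included.\<close>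

lemma norm_square_test_sum_le:
  assumes ab: "a \<le> b" and ps: "test_terms a b D ps"
  shows "ennreal ((norm (test_sum ps t))\<^sup>2) \<le>
    L2sq {a<..<b} (test_sum ps) + L2sq {a<..<b} (test_sum (deriv_terms ps))"
proof (cases "t \<in> {a<..<b}")
  case True
  note cont = test_sum_continuous[OF ps] test_sum_continuous[OF test_terms_deriv[OF ps]]
  show ?thesis
    by (rule L2sq_le_addI[OF cont(1) cont(2)], rule norm_square_le_integral[OF
          has_vector_derivative_at_within[OF test_sum_has_vector_derivative[OF ps]] cont(2)])
      (use True in \<open>simp_all add: test_sum_eq_0[OF ps]\<close>)
next
  case False
  then show ?thesis using test_sum_eq_0[OF ps] by simp
qed

text \<open>The pointwise bound is applied to p', whose own norm is then eliminated in favour of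
  those of p and p''.\<close>

lemma norm_square_deriv_test_sum_le:
  assumes ab: "a \<le> b" and ps: "test_terms a b D ps"
  shows "ennreal ((norm (test_sum (deriv_terms ps) t))\<^sup>2) \<le>
    2 * (L2sq {a<..<b} (test_sum ps) + L2sq {a<..<b} (test_sum (deriv_terms (deriv_terms ps))))"
    (is "_ \<le> 2 * (?x + ?z)")
proof -
  have "ennreal ((norm (test_sum (deriv_terms ps) t))\<^sup>2) \<le> L2sq {a<..<b} (test_sum (deriv_terms ps)) + ?z"
    by (rule norm_square_test_sum_le[OF ab test_terms_deriv[OF ps]])
  also have "\<dots> \<le> (?x + ?z) + (?x + ?z)"
    by (intro add_mono L2sq_deriv_le[OF ab ps]) (simp add: add_increasing)
  finally show ?thesis by (simp only: mult_2)
qed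

text \<open>Outside the interval all test sums are 0, so almost everywhere convergence extends to
  the line; the values of the limit stay in \<open>Hs\<close> because it is closed.\<close>

lemma test_sum_L2_limit:
  assumes f: "\<And>k. test_terms a b Hs (ps k)" and C: "L2_Cauchy {a<..<b} (\<lambda>k. test_sum (ps k))"
  obtains r g where "strict_mono r" "strongly_measurable_on UNIV g" "\<And>t. g t \<in> Hs"
    "AE t in lebesgue. (\<lambda>j. test_sum (ps (r j)) t) \<longlonglongrightarrow> g t"
    "(\<lambda>k. L2sq {a<..<b} (\<lambda>t. test_sum (ps k) t - g t)) \<longlonglongrightarrow> 0"
proof -
  note sm = test_sum_strongly_measurable[OF f]
  obtain r where r: "strict_mono r"
    "AE t in lebesgue. t \<in> {a<..<b} \<longrightarrow> convergent (\<lambda>j. test_sum (ps (r j)) t)"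
    using L2_Cauchy_AE_convergent_subseq[OF sm _ C] by auto
  \<comment> \<open>The default 0 belongs to the subspace \<open>Hs\<close>, so \<open>g\<close> is
    \<open>Hs\<close>-valued at every point.\<close>
  define g where "g t = (if convergent (\<lambda>j. test_sum (ps (r j)) t) then lim (\<lambda>j. test_sum (ps (r j)) t) else 0)" for t
  have lim: "(\<lambda>j. test_sum (ps (r j)) t) \<longlonglongrightarrow> g t" if "convergent (\<lambda>j. test_sum (ps (r j)) t)" for t
    using that by (simp add: g_def convergent_LIMSEQ_iff)
  have conv: "convergent (\<lambda>j. test_sum (ps (r j)) t)" if "t \<notin> {a<..<b}" for t
    using test_sum_eq_0[OF f that] by (simp add: convergent_const)
  have AE: "AE t in lebesgue. (\<lambda>j. test_sum (ps (r j)) t) \<longlonglongrightarrow> g t"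
    by (rule eventually_mono[OF r(2)]) (use lim conv in blast)
  show thesis
  proof
    show "strongly_measurable_on UNIV g"
      by (rule strongly_measurable_on_AE_LIMSEQ[of "\<lambda>j. test_sum (ps (r j))" a b])
        (use AE in \<open>auto intro!: test_sum_continuous[OF f] test_sum_eq_0[OF f]\<close>)
    show "g t \<in> Hs" for t
    proof (cases "convergent (\<lambda>j. test_sum (ps (r j)) t)")
      case True
      show ?thesis
        by (rule closed_sequentially[OF Hs_closed _ lim[OF True]]) (rule test_sum_mem[OF f Hs_subspace])
    next
      case False
      then show ?thesis using subspace_0[OF Hs_subspace] by (simp add: g_def)
    qed
    show "(\<lambda>k. L2sq {a<..<b} (\<lambda>t. test_sum (ps k) t - g t)) \<longlonglongrightarrow> 0"
      by (rule L2sq_LIMSEQ_of_Cauchy[OF sm _ C r(1)]) (auto intro: eventually_mono[OF AE])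
  qed (fact r(1), fact AE)
qed

end

section \<open>Passage to the closure\<close>

lemma L2sq_le_2_diff:
  assumes "strongly_measurable_on S q" "strongly_measurable_on S v" "S \<in> sets lebesgue"
  shows "L2sq S q \<le> 2 * L2sq S (\<lambda>t. q t - v t) + 2 * L2sq S v"
  using L2sq_triangle[OF assms(1) strongly_measurable_on_zero assms(2,3)] by simp

lemma L2sq_2_diff_tendsto:
  assumes "(\<lambda>k. L2sq S (\<lambda>t. q k t - v t)) \<longlonglongrightarrow> 0"
  shows "(\<lambda>k. 2 * L2sq S (\<lambda>t. q k t - v t) + 2 * L2sq S v) \<longlonglongrightarrow> 2 * L2sq S v"
proof -
  have "(\<lambda>k. 2 * L2sq S (\<lambda>t. q k t - v t) + 2 * L2sq S v) \<longlonglongrightarrow> 2 * 0 + 2 * L2sq S v"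
    by (intro tendsto_add ennreal_tendsto_cmult assms tendsto_const) simp
  then show ?thesis by simp
qed

text \<open>Fatou's lemma applied to \<open>p k - u\<close> gives \<open>U - u\<close> square norm
  0.\<close>

lemma AE_eq_of_L2_limit:
  assumes p: "\<And>k. strongly_measurable_on S (p k)" and u: "strongly_measurable_on S u"
    and S: "S \<in> sets lebesgue" and U: "strongly_measurable_on S U"
    and lim: "\<And>t. (\<lambda>k. p k t) \<longlonglongrightarrow> U t" and L2: "(\<lambda>k. L2sq S (\<lambda>t. p k t - u t)) \<longlonglongrightarrow> 0"
  shows "AE t in lebesgue. t \<in> S \<longrightarrow> U t = u t"
proof (rule L2sq_eq_0D[OF _ U u S])
  have "L2sq S (\<lambda>t. U t - u t) \<le> 0"
    by (rule L2sq_le_of_AE_LIMSEQ[OF strongly_measurable_on_diff[OF p u] S _ order_refl L2])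
      (auto intro!: tendsto_intros lim)
  then show "L2sq S (\<lambda>t. U t - u t) = 0" by simp
qed

text \<open>One interval with one sequence of test sums: the data extracted from membership of
  (\<open>u\<close>, \<open>v\<close>) in the closed graph.\<close>

locale test_approximation = pos_def_operator J Hs D A
  for J :: "'h::{real_inner, complete_space} \<Rightarrow> 'h" and Hs D :: "'h set" and A :: "'h \<Rightarrow> 'h" +
  fixes a b :: real and ps :: "nat \<Rightarrow> ((real \<Rightarrow> real) \<times> 'h) list" and u v :: "real \<Rightarrow> 'h"
  assumes ab: "a < b" and ps: "\<And>k. test_terms a b D (ps k)"
    and u: "strongly_measurable_on {a<..<b} u" and v: "strongly_measurable_on {a<..<b} v"
    and v_fin: "L2sq {a<..<b} v < \<infinity>"
    and u_lim: "(\<lambda>k. L2sq {a<..<b} (\<lambda>t. test_sum (ps k) t - u t)) \<longlonglongrightarrow> 0"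
    and v_lim: "(\<lambda>k. L2sq {a<..<b} (\<lambda>t. expr_sum (ps k) t - v t)) \<longlonglongrightarrow> 0"
begin

abbreviation "S \<equiv> {a<..<b}"
abbreviation "p k \<equiv> test_sum (ps k)"
abbreviation "p1 k \<equiv> test_sum (deriv_terms (ps k))"
abbreviation "p2 k \<equiv> test_sum (deriv_terms (deriv_terms (ps k)))"
abbreviation "pA k \<equiv> test_sum (image_terms A (ps k))"
abbreviation "q k \<equiv> expr_sum (ps k)"

lemmas ps1 = test_terms_deriv[OF ps]
lemmas ps2 = test_terms_deriv[OF ps1]
lemmas psA = test_terms_A[OF ps]

lemma S_sets: "S \<in> sets lebesgue" by simp

lemmas sm_p = test_sum_strongly_measurable[OF ps]
lemmas sm_p1 = test_sum_strongly_measurable[OF ps1]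
lemmas sm_p2 = test_sum_strongly_measurable[OF ps2]
lemmas sm_pA = test_sum_strongly_measurable[OF psA]
lemmas sm_q = expr_sum_strongly_measurable[OF ps]

lemma p2_Hs: "test_terms a b Hs (deriv_terms (deriv_terms (ps k)))"
  using ps2[of k] D_subset unfolding test_terms_def by blast

lemma Cauchy_p: "L2_Cauchy S p"
  by (rule L2_CauchyI[OF sm_p u S_sets u_lim])

lemma Cauchy_q: "L2_Cauchy S q"
  by (rule L2_CauchyI[OF sm_q v S_sets v_lim])

lemma L2sq_q: "L2sq S (q k) = L2sq S (p2 k) + L2sq S (pA k)"
  by (rule L2sq_expr_sum[OF less_imp_le[OF ab] ps])

text \<open>The difference of two test sums is again one, so the norm identity applies to it; each
  summand is then dominated by the difference of the \<open>q\<close>.\<close>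

lemma L2sq_diff_q:
  "L2sq S (\<lambda>t. q k t - q l t) = L2sq S (\<lambda>t. p2 k t - p2 l t) + L2sq S (\<lambda>t. pA k t - pA l t)"
proof -
  obtain rs where rs: "test_terms a b D rs"
    "\<And>t. test_sum (deriv_terms (deriv_terms rs)) t = p2 k t - p2 l t"
    "\<And>t. test_sum (image_terms A rs) t = pA k t - pA l t"
    "\<And>t. expr_sum rs t = q k t - q l t"
    using test_terms_diff[OF ps[of k] ps[of l]] by metis
  show ?thesis
    using L2sq_expr_sum[OF less_imp_le[OF ab] rs(1)] unfolding rs(2-4)[abs_def, symmetric] .
qed

lemma Cauchy_p2: "L2_Cauchy S p2"
  by (rule L2_Cauchy_mono[OF Cauchy_q]) (simp add: L2sq_diff_q)

lemma Cauchy_pA: "L2_Cauchy S pA"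
  by (rule L2_Cauchy_mono[OF Cauchy_q]) (simp add: L2sq_diff_q)

text \<open>Both bounds have the same right-hand side, free of p', so the Cauchy properties of
  \<open>p\<close> and \<open>p2\<close> suffice for uniform convergence of \<open>p\<close> and
  \<open>p1\<close>.\<close>

lemma norm_diff_p_le:
  shows "ennreal ((norm (p k t - p l t))\<^sup>2) \<le>
      2 * (L2sq S (\<lambda>t. p k t - p l t) + L2sq S (\<lambda>t. p2 k t - p2 l t))"
    and "ennreal ((norm (p1 k t - p1 l t))\<^sup>2) \<le>
      2 * (L2sq S (\<lambda>t. p k t - p l t) + L2sq S (\<lambda>t. p2 k t - p2 l t))"
proof -
  obtain rs where rs: "test_terms a b D rs"
    "\<And>t. test_sum rs t = p k t - p l t"
    "\<And>t. test_sum (deriv_terms rs) t = p1 k t - p1 l t"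
    "\<And>t. test_sum (deriv_terms (deriv_terms rs)) t = p2 k t - p2 l t"
    using test_terms_diff[OF ps[of k] ps[of l]] by metis
  let ?x = "L2sq S (test_sum rs)" and ?z = "L2sq S (test_sum (deriv_terms (deriv_terms rs)))"
  have "ennreal ((norm (test_sum rs t))\<^sup>2) \<le> ?x + (?x + ?z)"
    by (rule order_trans[OF norm_square_test_sum_le[OF less_imp_le[OF ab] rs(1)]])
      (intro add_mono order_refl L2sq_deriv_le[OF less_imp_le[OF ab] rs(1)])
  also have "\<dots> \<le> (?x + ?z) + (?x + ?z)"
    by (intro add_mono order_refl) simp
  finally have "ennreal ((norm (test_sum rs t))\<^sup>2) \<le> 2 * (?x + ?z)"
    by (simp only: mult_2)
  then show "ennreal ((norm (p k t - p l t))\<^sup>2) \<le>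
      2 * (L2sq S (\<lambda>t. p k t - p l t) + L2sq S (\<lambda>t. p2 k t - p2 l t))"
    unfolding rs(2,4)[abs_def, symmetric] rs(2,4)[symmetric] .
  show "ennreal ((norm (p1 k t - p1 l t))\<^sup>2) \<le>
      2 * (L2sq S (\<lambda>t. p k t - p l t) + L2sq S (\<lambda>t. p2 k t - p2 l t))"
    using norm_square_deriv_test_sum_le[OF less_imp_le[OF ab] rs(1), of t]
    unfolding rs(2,4)[abs_def, symmetric] rs(3)[symmetric] .
qed

lemma uniform_limits:
  obtains U U' where "uniform_limit UNIV p U sequentially" "uniform_limit UNIV p1 U' sequentially"
proof -
  have "uniformly_convergent_on UNIV p"
    by (rule Cauchy_uniformly_convergent, rule uniformly_Cauchy_of_L2_Cauchy[OF Cauchy_p Cauchy_p2])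
      (rule norm_diff_p_le)
  moreover have "uniformly_convergent_on UNIV p1"
    by (rule Cauchy_uniformly_convergent, rule uniformly_Cauchy_of_L2_Cauchy[OF Cauchy_p Cauchy_p2])
      (rule norm_diff_p_le)
  ultimately show thesis using that unfolding uniformly_convergent_on_def by blast
qed

text \<open>The square norm of \<open>q\<close> is compared with that of \<open>v\<close> by the
  doubled triangle inequality, whose error term tends to 0; this is where the factor 2
  arises.\<close>

lemma L2sq_le_v:
  assumes f: "\<And>k. strongly_measurable_on S (f k)" and le: "\<And>k. L2sq S (f k) \<le> L2sq S (q k)"
    and r: "strict_mono r" and lim: "AE t in lebesgue. (\<lambda>j. f (r j) t) \<longlonglongrightarrow> g t"
  shows "L2sq S g \<le> 2 * L2sq S v"
proof (rule L2sq_le_of_AE_LIMSEQ[OF f S_sets])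
  show "AE t in lebesgue. t \<in> S \<longrightarrow> (\<lambda>j. f (r j) t) \<longlonglongrightarrow> g t"
    by (rule eventually_mono[OF lim]) simp
  show "L2sq S (f (r j)) \<le> 2 * L2sq S (\<lambda>t. q (r j) t - v t) + 2 * L2sq S v" for j
    by (rule order_trans[OF le L2sq_le_2_diff[OF sm_q v S_sets]])
  show "(\<lambda>j. 2 * L2sq S (\<lambda>t. q (r j) t - v t) + 2 * L2sq S v) \<longlonglongrightarrow> 2 * L2sq S v"
    using LIMSEQ_subseq_LIMSEQ[OF L2sq_2_diff_tendsto[OF v_lim] r] by (simp add: o_def)
qed

text \<open>The fundamental theorem tested against \<open>h\<close>; the contribution at
  \<open>a\<close> is 0 because p' vanishes there.\<close>

lemma inner_p1:
  assumes t: "t \<in> {a..b}"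
  shows "(LINT s:{a..t}|lebesgue. inner (p2 k s) h) = inner (p1 k t) h"
proof -
  have "continuous_on {a..t} (\<lambda>s. inner (p2 k s) h)"
    by (intro continuous_intros test_sum_continuous[OF ps2])
  then have "(\<lambda>s. inner (p2 k s) h) absolutely_integrable_on {a..t}"
    using absolutely_integrable_continuous[of a t] by simp
  then have "(LINT s:{a..t}|lebesgue. inner (p2 k s) h) = integral {a..t} (\<lambda>s. inner (p2 k s) h)"
    by (rule set_lebesgue_integral_eq_integral(2))
  moreover have "((\<lambda>s. inner (p1 k s) h) has_vector_derivative inner (p2 k s) h) (at s within {a..t})" for s
    by (rule has_vector_derivative_at_within, rule bounded_linear.has_vector_derivative[OF bounded_linear_inner_left
          test_sum_has_vector_derivative[OF ps1]])
  then have "((\<lambda>s. inner (p2 k s) h) has_integral inner (p1 k t) h - inner (p1 k a) h) {a..t}"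
    using t by (intro fundamental_theorem_of_calculus) auto
  then have "integral {a..t} (\<lambda>s. inner (p2 k s) h) = inner (p1 k t) h - inner (p1 k a) h"
    by (rule integral_unique)
  ultimately show ?thesis by (simp add: test_sum_eq_0[OF ps1])
qed

lemma regularity:
  "(\<exists>U U' W. W22_0_piece a b Hs u U U' W \<and> L2sq S U' \<le> 2 * L2sq S u + 2 * L2sq S v \<and>
      L2sq S W \<le> 2 * L2sq S v) \<and>
    (AE t in lebesgue. t \<in> S \<longrightarrow> u t \<in> D) \<and> L2on S Hs (\<lambda>t. A (u t)) \<and>
    L2sq S (\<lambda>t. A (u t)) \<le> 2 * L2sq S v"
proof -
  obtain U U' where U: "uniform_limit UNIV p U sequentially" and U': "uniform_limit UNIV p1 U' sequentially"
    by (rule uniform_limits)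
  have p_lim: "(\<lambda>k. p k t) \<longlonglongrightarrow> U t" and p1_lim: "(\<lambda>k. p1 k t) \<longlonglongrightarrow> U' t" for t
    using U U' by (auto intro: tendsto_uniform_limitI)
  obtain r W where r: "strict_mono r" and W: "strongly_measurable_on UNIV W" "\<And>t. W t \<in> Hs"
    "AE t in lebesgue. (\<lambda>j. p2 (r j) t) \<longlonglongrightarrow> W t" "(\<lambda>k. L2sq S (\<lambda>t. p2 k t - W t)) \<longlonglongrightarrow> 0"
    by (rule test_sum_L2_limit[OF p2_Hs Cauchy_p2]) (rule that)
  \<comment> \<open>The subsequences \<open>r\<close> and \<open>r'\<close> may differ:
    \<open>p\<close> and \<open>p1\<close> converge along the full sequence, hence along either of
    them.\<close>
  obtain r' Y where r': "strict_mono r'" and Y: "strongly_measurable_on UNIV Y" "\<And>t. Y t \<in> Hs"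
    "AE t in lebesgue. (\<lambda>j. pA (r' j) t) \<longlonglongrightarrow> Y t"
    by (rule test_sum_L2_limit[OF psA Cauchy_pA]) (rule that)
  have sub: "strongly_measurable_on S f" if "strongly_measurable_on UNIV f" for f :: "real \<Rightarrow> 'h"
    by (rule strongly_measurable_on_subset[OF that]) simp
  have W_le: "L2sq S W \<le> 2 * L2sq S v"
    by (rule L2sq_le_v[OF sm_p2 _ r W(3)]) (simp add: L2sq_q)
  have Y_le: "L2sq S Y \<le> 2 * L2sq S v"
    by (rule L2sq_le_v[OF sm_pA _ r' Y(3)]) (simp add: L2sq_q)
  have v2: "2 * L2sq S v < \<infinity>" using v_fin by (simp add: ennreal_mult_less_top)
  have U_meas: "strongly_measurable_on S U"
    by (rule strongly_measurable_on_AE_LIMSEQ[of p a b])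
      (use p_lim test_sum_continuous[OF ps] test_sum_eq_0[OF ps] in auto)
  have U_eq: "AE t in lebesgue. t \<in> S \<longrightarrow> U t = u t"
    by (rule AE_eq_of_L2_limit[OF sm_p u S_sets U_meas p_lim u_lim])

  have U'_le: "L2sq S U' \<le> 2 * L2sq S u + 2 * L2sq S v"
  proof (rule L2sq_le_of_AE_LIMSEQ[OF sm_p1 S_sets])
    show "AE t in lebesgue. t \<in> S \<longrightarrow> (\<lambda>k. p1 k t) \<longlonglongrightarrow> U' t" using p1_lim by simp
    show "L2sq S (p1 k) \<le> (2 * L2sq S (\<lambda>t. p k t - u t) + 2 * L2sq S u) +
        (2 * L2sq S (\<lambda>t. q k t - v t) + 2 * L2sq S v)" for k
    proof (rule order_trans[OF L2sq_deriv_le[OF less_imp_le[OF ab] ps]], rule add_mono)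
      show "L2sq S (p k) \<le> 2 * L2sq S (\<lambda>t. p k t - u t) + 2 * L2sq S u"
        by (rule L2sq_le_2_diff[OF sm_p u S_sets])
      have "L2sq S (p2 k) \<le> L2sq S (q k)" by (simp add: L2sq_q)
      also have "\<dots> \<le> 2 * L2sq S (\<lambda>t. q k t - v t) + 2 * L2sq S v"
        by (rule L2sq_le_2_diff[OF sm_q v S_sets])
      finally show "L2sq S (p2 k) \<le> 2 * L2sq S (\<lambda>t. q k t - v t) + 2 * L2sq S v" .
    qed
    show "(\<lambda>k. (2 * L2sq S (\<lambda>t. p k t - u t) + 2 * L2sq S u) +
        (2 * L2sq S (\<lambda>t. q k t - v t) + 2 * L2sq S v)) \<longlonglongrightarrow> 2 * L2sq S u + 2 * L2sq S v"
      by (intro tendsto_add L2sq_2_diff_tendsto u_lim v_lim)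
  qed

  have ends: "U a = 0" "U b = 0" "U' a = 0" "U' b = 0"
    using p_lim[of a] p_lim[of b] p1_lim[of a] p1_lim[of b]
    by (simp_all add: test_sum_eq_0[OF ps] test_sum_eq_0[OF ps1] LIMSEQ_const_iff)
  have weak: "inner (U' t) h = inner (U' a) h + (LINT s:{a..t}|lebesgue. inner (W s) h)"
    if t: "t \<in> {a..b}" for h t
  proof -
    \<comment> \<open>\<open>inner_p1\<close> rewrites these integrals as inner products with p',
      which converge pointwise; the base term of the claim is 0 since
      \<open>U' a = 0\<close>.\<close>
    have "(\<lambda>k. LINT s:{a..t}|lebesgue. inner (p2 k s) h) \<longlonglongrightarrow> (LINT s:{a..t}|lebesgue. inner (W s) h)"
    proof (rule set_integral_inner_tendsto[OF t sm_p2 W(1) _ _ W(4)])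
      show "L2sq S (p2 k) < \<infinity>" for k
        by (simp only: L2sq_continuous[OF test_sum_continuous[OF ps2]]) simp
      show "L2sq S W < \<infinity>" using W_le v2 by (rule le_less_trans)
    qed
    then have "(\<lambda>k. inner (p1 k t) h) \<longlonglongrightarrow> (LINT s:{a..t}|lebesgue. inner (W s) h)"
      by (simp only: inner_p1[OF t])
    moreover have "(\<lambda>k. inner (p1 k t) h) \<longlonglongrightarrow> inner (U' t) h"
      by (intro tendsto_intros p1_lim)
    ultimately have "inner (U' t) h = (LINT s:{a..t}|lebesgue. inner (W s) h)"
      by (metis LIMSEQ_unique)
    then show ?thesis by (simp add: ends)
  qed
  have deriv: "(U has_vector_derivative U' t) (at t within {a..b})" for t
    by (rule has_vector_derivative_at_within,
        rule uniform_limit_has_vector_derivative[OF test_sum_has_vector_derivative[OF ps]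
          test_sum_continuous[OF ps1] p_lim U'])
  have "L2on S Hs W"
    using sub[OF W(1)] W(2) le_less_trans[OF W_le v2] by (simp add: L2on_def)
  then have piece: "W22_0_piece a b Hs u U U' W"
    using U_eq weak deriv ends by (simp add: W22_0_piece_def)

  \<comment> \<open>Closedness of \<open>A\<close> is used in the value space, at almost every fixed
    \<open>t\<close>, for the sequence \<open>p (r' j) t\<close> in \<open>D\<close>.\<close>
  have AE_A: "AE t in lebesgue. t \<in> S \<longrightarrow> u t \<in> D \<and> A (u t) = Y t"
    using Y(3) U_eq
  proof eventually_elim
    case (elim t)
    have 1: "(\<lambda>j. p (r' j) t) \<longlonglongrightarrow> U t"
      using LIMSEQ_subseq_LIMSEQ[OF p_lim r'] by (simp add: o_def)
    have 2: "(\<lambda>j. A (p (r' j) t)) \<longlonglongrightarrow> Y t"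
      using elim(1) by (simp only: test_sum_A[OF ps])
    have "U t \<in> D" "A (U t) = Y t"
      using A_closed[OF test_sum_mem[OF ps D_subspace] 1 2] by auto
    then show ?case using elim(2) by auto
  qed
  \<comment> \<open>\<open>A (u t)\<close> is arbitrary on the null set where \<open>u t\<close> is
    outside \<open>D\<close>; measurability and the bound are inherited from
    \<open>Y\<close>.\<close>
  have Y_eq: "AE t in lebesgue. t \<in> S \<longrightarrow> Y t = A (u t)"
    by (rule eventually_mono[OF AE_A]) simp
  have A_le: "L2sq S (\<lambda>t. A (u t)) \<le> 2 * L2sq S v"
    using Y_le L2sq_cong_AE[OF Y_eq] by simp
  have "AE t in lebesgue. t \<in> S \<longrightarrow> A (u t) \<in> Hs"
    by (rule eventually_mono[OF AE_A]) (use Y(2) in auto)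
  then have "L2on S Hs (\<lambda>t. A (u t))"
    using strongly_measurable_on_cong_AE[OF sub[OF Y(1)] Y_eq] le_less_trans[OF A_le v2]
    by (simp add: L2on_def)
  moreover have "AE t in lebesgue. t \<in> S \<longrightarrow> u t \<in> D"
    by (rule eventually_mono[OF AE_A]) simp
  ultimately show ?thesis using piece U'_le W_le A_le by blast
qed

end

section \<open>From the closed graph on one interval to the direct sum\<close>

lemma (in pos_def_operator) closure_regularity:
  assumes ab: "a < b" and uv: "(u, v) \<in> L2_graph_closure {a<..<b} Hs (lpre_graph a b J D A)"
  shows "(\<exists>U U' W. W22_0_piece a b Hs u U U' W \<and>
      L2sq {a<..<b} U' \<le> 2 * L2sq {a<..<b} u + 2 * L2sq {a<..<b} v \<and>
      L2sq {a<..<b} W \<le> 2 * L2sq {a<..<b} v) \<and>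
    (AE t in lebesgue. t \<in> {a<..<b} \<longrightarrow> u t \<in> D) \<and> L2on {a<..<b} Hs (\<lambda>t. A (u t)) \<and>
    L2sq {a<..<b} (\<lambda>t. A (u t)) \<le> 2 * L2sq {a<..<b} v"
proof -
  obtain s where s: "\<And>k. s k \<in> lpre_graph a b J D A"
    "(\<lambda>k. L2sq {a<..<b} (\<lambda>t. fst (s k) t - u t)) \<longlonglongrightarrow> 0"
    "(\<lambda>k. L2sq {a<..<b} (\<lambda>t. snd (s k) t - v t)) \<longlonglongrightarrow> 0"
    and L2: "L2on {a<..<b} Hs u" "L2on {a<..<b} Hs v"
    using uv unfolding L2_graph_closure_def by blast
  have "\<forall>k. \<exists>ps. s k = (test_sum ps, expr_sum ps) \<and> test_terms a b D ps"
    using s(1) unfolding lpre_graph_eq by blast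
  then obtain ps where ps: "\<And>k. s k = (test_sum (ps k), expr_sum (ps k))" "\<And>k. test_terms a b D (ps k)"
    by metis
  interpret test_approximation J Hs D A a b ps u v
    using ab ps(2) L2 s(2,3) by unfold_locales (auto simp: L2on_def ps(1))
  show ?thesis by (rule regularity)
qed

theorem theorem2p5:
  fixes a b :: "nat \<Rightarrow> real"
    and J :: "'h::{real_inner, complete_space} \<Rightarrow> 'h"
    and H D :: "nat \<Rightarrow> 'h set"
    and A :: "nat \<Rightarrow> 'h \<Rightarrow> 'h"
  assumes ab: "\<forall>n. a n < b n" "\<forall>n. b n \<le> a (Suc n)"
    and J: "complex_structure J"
    and H: "\<forall>n. complex_hilbert_subspace J (H n)"
    and A: "\<forall>n. pos_def_selfadjoint J (H n) (D n) (A n)"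
    and fn: "formally_normal a b H (L0_graph a b H J D A)"
  shows "\<forall>(U, V)\<in>L0_graph a b H J D A. W22_0_sum a b H U \<and> A_image_in_L2 a b H D A U"
proof (clarify)
  fix U V assume UV: "(U, V) \<in> L0_graph a b H J D A"
  let ?u = "\<lambda>n. L2sq (Delta a b n) (U n)" and ?v = "\<lambda>n. L2sq (Delta a b n) (V n)"
  have fin: "(\<Sum>n. ?u n) < \<infinity>" "(\<Sum>n. ?v n) < \<infinity>"
    using UV by (auto simp: L0_graph_def L2sum_def)
  have reg: "(\<exists>Ur Ud W. W22_0_piece (a n) (b n) (H n) (U n) Ur Ud W \<and>
        L2sq (Delta a b n) Ud \<le> 2 * ?u n + 2 * ?v n \<and> L2sq (Delta a b n) W \<le> 2 * ?v n) \<and>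
      (AE t in lebesgue. t \<in> Delta a b n \<longrightarrow> U n t \<in> D n) \<and>
      L2on (Delta a b n) (H n) (\<lambda>t. A n (U n t)) \<and> L2sq (Delta a b n) (\<lambda>t. A n (U n t)) \<le> 2 * ?v n" for n
  proof -
    interpret pos_def_operator J "H n" "D n" "A n"
      using J H A by unfold_locales auto
    have "(U n, V n) \<in> L2_graph_closure {a n<..<b n} (H n) (lpre_graph (a n) (b n) J (D n) (A n))"
      using UV by (auto simp: L0_graph_def Delta_def)
    then show ?thesis
      unfolding Delta_def using ab(1) by (intro closure_regularity) auto
  qed
  have "\<forall>n. \<exists>Ur Ud W. W22_0_piece (a n) (b n) (H n) (U n) Ur Ud W \<and>
        L2sq (Delta a b n) Ud \<le> 2 * ?u n + 2 * ?v n \<and> L2sq (Delta a b n) W \<le> 2 * ?v n"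
    by (rule allI) (rule conjunct1[OF reg])
  then obtain Ur Ud W where R: "\<And>n. W22_0_piece (a n) (b n) (H n) (U n) (Ur n) (Ud n) (W n)"
      "\<And>n. L2sq (Delta a b n) (Ud n) \<le> 2 * ?u n + 2 * ?v n" "\<And>n. L2sq (Delta a b n) (W n) \<le> 2 * ?v n"
    unfolding choice_iff by blast
  have sum_fin: "(\<Sum>n. x * ?u n + y * ?v n) < \<infinity>" if "x < \<infinity>" "y < \<infinity>" for x y :: ennreal
  proof -
    have "(\<Sum>n. x * ?u n + y * ?v n) = x * (\<Sum>n. ?u n) + y * (\<Sum>n. ?v n)"
      by (simp add: suminf_add[symmetric] summableI ennreal_suminf_cmult)
    also have "\<dots> < \<infinity>" using fin that by (simp add: ennreal_mult_less_top)
    finally show ?thesis .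
  qed
  \<comment> \<open>The coefficients collect u + (2u + 2v) + 2v, one summand each for the function
    and its first and second derivative.\<close>
  have "(\<Sum>n. ?u n + L2sq (Delta a b n) (Ud n) + L2sq (Delta a b n) (W n)) \<le> (\<Sum>n. 3 * ?u n + 4 * ?v n)"
  proof (intro suminf_le summableI allI)
    fix n
    have "?u n + L2sq (Delta a b n) (Ud n) + L2sq (Delta a b n) (W n) \<le> ?u n + (2 * ?u n + 2 * ?v n) + 2 * ?v n"
      by (intro add_mono R order_refl)
    also have "\<dots> = (1 + 2) * ?u n + (2 + 2) * ?v n"
      unfolding distrib_right by (simp add: ac_simps)
    finally show "?u n + L2sq (Delta a b n) (Ud n) + L2sq (Delta a b n) (W n) \<le> 3 * ?u n + 4 * ?v n"
      by simp
  qed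
  also have "\<dots> < \<infinity>" by (rule sum_fin) auto
  finally have "W22_0_sum a b H U"
    using R(1) unfolding W22_0_sum_def by blast
  \<comment> \<open>The coefficient 0 brings the bound into the form covered by
    \<open>sum_fin\<close>.\<close>
  moreover have "(\<Sum>n. L2sq (Delta a b n) (\<lambda>t. A n (U n t))) \<le> (\<Sum>n. 0 * ?u n + 2 * ?v n)"
    using reg by (intro suminf_le summableI allI) auto
  then have "(\<Sum>n. L2sq (Delta a b n) (\<lambda>t. A n (U n t))) < \<infinity>"
    using sum_fin[of 0 2] by (rule le_less_trans) auto
  then have "A_image_in_L2 a b H D A U"
    using reg unfolding A_image_in_L2_def L2sum_def by blast
  ultimately show "W22_0_sum a b H U \<and> A_image_in_L2 a b H D A U" ..
qed

end
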